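(* For every ring $R$, the symmetric Lambek torsion theory and the symmetric Goldie torsion theory are differential.
   Context: Rings are associative with identity and modules are unital. Derivations. A derivation on a ring $R$ is an additive map $\delta:R\to R$ with $\delta(rs)=\delta(r)s+r\delta(s)$. Every derivation $\delta$ on $R$ determines a derivation $\overline{\delta}$ on $R\otimes_{\mathbb{Z}}R^{op}$ by $\overline{\delta}(r\otimes s)=\delta(r)\otimes s+r\otimes\delta(s)$. Symmetric filter. An $R$-bimodule is a right $R\otimes_{\mathbb{Z}}R^{op}$-module via $x(r\otimes s)=sxr$. If $\mathfrak{F}_l$ is a Gabriel filter of left ideals and $\mathfrak{F}_r$ a Gabriel filter of right ideals of $R$, with torsion theories $\tau_l,\tau_r$, then the symmetric filter ${}_l\mathfrak{F}_r$ induced by them is the set of right ideals of $R\otimes_{\mathbb{Z}}R^{op}$ containing one of the form $J\otimes R^{op}+R\otimes I$ (the sum of the images in $R\otimes_{\mathbb{Z}}R^{op}$) with $I\in\mathfrak{F}_l$, $J\in\mathfrak{F}_r$. It is a Gabriel filter; its torsion theory ${}_l\tau_r$ of $R$-bimodules is the theory induced by $\tau_l$ and $\tau_r$, and its torsion class consists of the bimodules that are both $\tau_l$-torsion and $\tau_r$-torsion. Differential. ${}_l\mathfrak{F}_r$ (or ${}_l\tau_r$) is differential if for every $I\in{}_l\mathfrak{F}_r$ there is $J\in{}_l\mathfrak{F}_r$ such that $\overline{\delta}(J)\subseteq I$ for all derivations $\overline{\delta}$ of the ring $R\otimes_{\mathbb{Z}}R^{op}$. Particular theories. The symmetric Lambek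 torsion theory is induced by the left and right Lambek torsion theories (whose Gabriel filters are the dense left ideals and the dense right ideals of $R$, respectively). The symmetric Goldie torsion theory is induced by the left and right Goldie torsion theories (whose torsion-free classes are the nonsingular left modules and the nonsingular right modules, respectively). *)

theory Defs
  imports "HOL-Algebra.Free_Abelian_Groups" "HOL-Algebra.Generated_Groups" "HOL-Algebra.QuotRing"
    "HOL-Algebra.Module"
begin

section \<open>Opposite rings, one-sided ideals and right modules\<close>

text \<open>
  All rings are in the sense of the locale \<^locale>\<open>ring\<close>: associative, unital, not necessarily
  commutative; the zero ring is allowed.  Left ideals and left modules over \<open>R\<close> are right ideals
  and right modules over the opposite ring of \<open>R\<close>, so only the right-hand notions are defined.
\<close>

definition op_ring :: "('a, 'm) ring_scheme \<Rightarrow> ('a, 'm) ring_scheme"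
  where "op_ring R = R\<lparr>mult := \<lambda>x y. y \<otimes>\<^bsub>R\<^esub> x\<rparr>"

definition right_ideal :: "('a, 'm) ring_scheme \<Rightarrow> 'a set \<Rightarrow> bool"
  where "right_ideal R I \<longleftrightarrow>
    additive_subgroup I R \<and> (\<forall>a\<in>I. \<forall>r\<in>carrier R. a \<otimes>\<^bsub>R\<^esub> r \<in> I)"

text \<open>
  The type of module records of the library is reused for right modules, whose theory there is
  restricted to commutative rings: \<open>smult M r x\<close> stands for \<open>x r\<close>, hence the order of the factors
  in the associativity law.  The \<open>mult\<close> and \<open>one\<close> fields of a module are irrelevant.
\<close>

locale right_module = R?: ring R + M?: abelian_group M
  for R (structure) and M :: "('a, 'b, 'c) module_scheme" (structure) +
  assumes rsmult_closed:
      "\<lbrakk>r \<in> carrier R; x \<in> carrier M\<rbrakk> \<Longrightarrow> r \<odot>\<^bsub>M\<^esub> x \<in> carrier M"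
    and rsmult_distrib_ring:
      "\<lbrakk>r \<in> carrier R; s \<in> carrier R; x \<in> carrier M\<rbrakk> \<Longrightarrow>
        (r \<oplus>\<^bsub>R\<^esub> s) \<odot>\<^bsub>M\<^esub> x = r \<odot>\<^bsub>M\<^esub> x \<oplus>\<^bsub>M\<^esub> s \<odot>\<^bsub>M\<^esub> x"
    and rsmult_distrib_module:
      "\<lbrakk>r \<in> carrier R; x \<in> carrier M; y \<in> carrier M\<rbrakk> \<Longrightarrow>
        r \<odot>\<^bsub>M\<^esub> (x \<oplus>\<^bsub>M\<^esub> y) = r \<odot>\<^bsub>M\<^esub> x \<oplus>\<^bsub>M\<^esub> r \<odot>\<^bsub>M\<^esub> y"
    and rsmult_assoc:
      "\<lbrakk>r \<in> carrier R; s \<in> carrier R; x \<in> carrier M\<rbrakk> \<Longrightarrow>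
        (r \<otimes>\<^bsub>R\<^esub> s) \<odot>\<^bsub>M\<^esub> x = s \<odot>\<^bsub>M\<^esub> (r \<odot>\<^bsub>M\<^esub> x)"
    and rsmult_one: "x \<in> carrier M \<Longrightarrow> \<one>\<^bsub>R\<^esub> \<odot>\<^bsub>M\<^esub> x = x"

definition right_module_hom ::
  "('a, 'm) ring_scheme \<Rightarrow> ('a, 'b) module \<Rightarrow> ('a, 'c) module \<Rightarrow> ('b \<Rightarrow> 'c) set"
  where "right_module_hom R M N =
    {f. f \<in> carrier M \<rightarrow> carrier N \<and>
        (\<forall>x\<in>carrier M. \<forall>y\<in>carrier M. f (x \<oplus>\<^bsub>M\<^esub> y) = f x \<oplus>\<^bsub>N\<^esub> f y) \<and>
        (\<forall>r\<in>carrier R. \<forall>x\<in>carrier M. f (r \<odot>\<^bsub>M\<^esub> x) = r \<odot>\<^bsub>N\<^esub> f x)}"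

definition quotient_module :: "('a, 'm) ring_scheme \<Rightarrow> 'a set \<Rightarrow> ('a, 'a set) module"
  where "quotient_module R I =
    \<lparr>carrier = a_rcosets\<^bsub>R\<^esub> I, mult = undefined, one = undefined, zero = I, add = set_add R,
     smult = \<lambda>r X. \<Union>x\<in>X. I +>\<^bsub>R\<^esub> (x \<otimes>\<^bsub>R\<^esub> r)\<rparr>"


section \<open>Torsion theories and their filters of right ideals\<close>

definition torsion_class ::
  "('a, 'm) ring_scheme \<Rightarrow> ('a, 'c) module set \<Rightarrow> ('a, 'b) module set"
  where "torsion_class R F =
    {M. right_module R M \<and>
        (\<forall>N\<in>F. \<forall>f\<in>right_module_hom R M N. \<forall>x\<in>carrier M. f x = \<zero>\<^bsub>N\<^esub>)}"

definition torsion_filter :: "('a, 'm) ring_scheme \<Rightarrow> ('a, 'a set) module set \<Rightarrow> 'a set set"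
  where "torsion_filter R T = {I. right_ideal R I \<and> quotient_module R I \<in> T}"

definition essential_right_ideal :: "('a, 'm) ring_scheme \<Rightarrow> 'a set \<Rightarrow> bool"
  where "essential_right_ideal R I \<longleftrightarrow>
    right_ideal R I \<and> (\<forall>K. right_ideal R K \<and> K \<noteq> {\<zero>\<^bsub>R\<^esub>} \<longrightarrow> I \<inter> K \<noteq> {\<zero>\<^bsub>R\<^esub>})"

definition annihilator :: "('a, 'm) ring_scheme \<Rightarrow> ('a, 'b) module \<Rightarrow> 'b \<Rightarrow> 'a set"
  where "annihilator R M x = {r \<in> carrier R. r \<odot>\<^bsub>M\<^esub> x = \<zero>\<^bsub>M\<^esub>}"

definition singular_submodule :: "('a, 'm) ring_scheme \<Rightarrow> ('a, 'b) module \<Rightarrow> 'b set"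
  where "singular_submodule R M = {x \<in> carrier M. essential_right_ideal R (annihilator R M x)}"

definition nonsingular_modules :: "('a, 'm) ring_scheme \<Rightarrow> ('a, 'b) module set"
  where "nonsingular_modules R = {N. right_module R N \<and> singular_submodule R N = {\<zero>\<^bsub>N\<^esub>}}"

text \<open>
  A definition cannot range over modules with arbitrary carrier types, so the torsion-free class
  is taken among modules carried by sets of type \<open>'a set\<close>.  This loses nothing: the image of
  \<open>R/I\<close> in a nonsingular module is again nonsingular and isomorphic to some \<open>R/K\<close>; see lemma
  \<open>right_goldie_filter_hom_trivial\<close> below.
\<close>

definition right_goldie_filter :: "('a, 'm) ring_scheme \<Rightarrow> 'a set set"
  where "right_goldie_filter R =
    torsion_filter R (torsion_class R (nonsingular_modules R :: ('a, 'a set) module set))"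

definition left_goldie_filter :: "('a, 'm) ring_scheme \<Rightarrow> 'a set set"
  where "left_goldie_filter R = right_goldie_filter (op_ring R)"

definition dense_right_ideal :: "('a, 'm) ring_scheme \<Rightarrow> 'a set \<Rightarrow> bool"
  where "dense_right_ideal R I \<longleftrightarrow>
    right_ideal R I \<and>
    (\<forall>a\<in>carrier R. \<forall>b\<in>carrier R. a \<noteq> \<zero>\<^bsub>R\<^esub> \<longrightarrow>
      (\<exists>r\<in>carrier R. a \<otimes>\<^bsub>R\<^esub> r \<noteq> \<zero>\<^bsub>R\<^esub> \<and> b \<otimes>\<^bsub>R\<^esub> r \<in> I))"

definition right_lambek_filter :: "('a, 'm) ring_scheme \<Rightarrow> 'a set set"
  where "right_lambek_filter R = {I. dense_right_ideal R I}"

definition left_lambek_filter :: "('a, 'm) ring_scheme \<Rightarrow> 'a set set"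
  where "left_lambek_filter R = right_lambek_filter (op_ring R)"


section \<open>The tensor product of two rings over the integers\<close>

text \<open>
  The tensor product is the free abelian group on \<open>R \<times> S\<close>, with the multiplication extending
  \<open>(a, b) (c, d) = (a c, b d)\<close> biadditively, modulo the subgroup generated by the bilinearity
  relations.  That this subgroup is an ideal, so that the quotient is a ring, is shown below.
\<close>

definition pair_mult ::
  "('a, 'm) ring_scheme \<Rightarrow> ('b, 'n) ring_scheme \<Rightarrow>
    ('a \<times> 'b \<Rightarrow>\<^sub>0 int) \<Rightarrow> ('a \<times> 'b \<Rightarrow>\<^sub>0 int) \<Rightarrow> ('a \<times> 'b \<Rightarrow>\<^sub>0 int)"
  where "pair_mult R S x y =
    frag_extend (\<lambda>(a, b). frag_extend (\<lambda>(c, d). frag_of (a \<otimes>\<^bsub>R\<^esub> c, b \<otimes>\<^bsub>S\<^esub> d)) y) x"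

definition pair_ring ::
  "('a, 'm) ring_scheme \<Rightarrow> ('b, 'n) ring_scheme \<Rightarrow> ('a \<times> 'b \<Rightarrow>\<^sub>0 int) ring"
  where "pair_ring R S =
    \<lparr>carrier = carrier (free_Abelian_group (carrier R \<times> carrier S)), mult = pair_mult R S,
     one = frag_of (\<one>\<^bsub>R\<^esub>, \<one>\<^bsub>S\<^esub>), zero = 0, add = (+)\<rparr>"

definition bilinear_relations ::
  "('a, 'm) ring_scheme \<Rightarrow> ('b, 'n) ring_scheme \<Rightarrow> ('a \<times> 'b \<Rightarrow>\<^sub>0 int) set"
  where "bilinear_relations R S =
    {frag_of (a \<oplus>\<^bsub>R\<^esub> a', b) - frag_of (a, b) - frag_of (a', b) | a a' b.
        a \<in> carrier R \<and> a' \<in> carrier R \<and> b \<in> carrier S} \<union>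
    {frag_of (a, b \<oplus>\<^bsub>S\<^esub> b') - frag_of (a, b) - frag_of (a, b') | a b b'.
        a \<in> carrier R \<and> b \<in> carrier S \<and> b' \<in> carrier S}"

definition bilinear_subgroup ::
  "('a, 'm) ring_scheme \<Rightarrow> ('b, 'n) ring_scheme \<Rightarrow> ('a \<times> 'b \<Rightarrow>\<^sub>0 int) set"
  where "bilinear_subgroup R S =
    generate (free_Abelian_group (carrier R \<times> carrier S)) (bilinear_relations R S)"

definition tensor_ring ::
  "('a, 'm) ring_scheme \<Rightarrow> ('b, 'n) ring_scheme \<Rightarrow> ('a \<times> 'b \<Rightarrow>\<^sub>0 int) set ring"
  where "tensor_ring R S = pair_ring R S Quot bilinear_subgroup R S"

definition pure_tensor ::
  "('a, 'm) ring_scheme \<Rightarrow> ('b, 'n) ring_scheme \<Rightarrow> 'a \<Rightarrow> 'b \<Rightarrow> ('a \<times> 'b \<Rightarrow>\<^sub>0 int) set"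
  where "pure_tensor R S a b = bilinear_subgroup R S +>\<^bsub>pair_ring R S\<^esub> frag_of (a, b)"

text \<open>The image of \<open>A \<otimes> B\<close> in \<open>R \<otimes> S\<close>, for additive subgroups \<open>A\<close> of \<open>R\<close> and \<open>B\<close> of \<open>S\<close>:\<close>

definition tensor_image ::
  "('a, 'm) ring_scheme \<Rightarrow> ('b, 'n) ring_scheme \<Rightarrow> 'a set \<Rightarrow> 'b set \<Rightarrow>
    ('a \<times> 'b \<Rightarrow>\<^sub>0 int) set set"
  where "tensor_image R S A B =
    generate (add_monoid (tensor_ring R S)) {pure_tensor R S a b | a b. a \<in> A \<and> b \<in> B}"

abbreviation enveloping_ring :: "('a, 'm) ring_scheme \<Rightarrow> ('a \<times> 'a \<Rightarrow>\<^sub>0 int) set ring"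
  where "enveloping_ring R \<equiv> tensor_ring R (op_ring R)"


section \<open>Symmetric filters\<close>

definition symmetric_filter ::
  "('a, 'm) ring_scheme \<Rightarrow> 'a set set \<Rightarrow> 'a set set \<Rightarrow> ('a \<times> 'a \<Rightarrow>\<^sub>0 int) set set set"
  where "symmetric_filter R Fl Fr =
    {K. right_ideal (enveloping_ring R) K \<and>
        (\<exists>I\<in>Fl. \<exists>J\<in>Fr.
          tensor_image R (op_ring R) J (carrier (op_ring R))
            <+>\<^bsub>enveloping_ring R\<^esub> tensor_image R (op_ring R) (carrier R) I \<subseteq> K)}"

definition symmetric_lambek_filter ::
  "('a, 'm) ring_scheme \<Rightarrow> ('a \<times> 'a \<Rightarrow>\<^sub>0 int) set set set"
  where "symmetric_lambek_filter R =
    symmetric_filter R (left_lambek_filter R) (right_lambek_filter R)"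

definition symmetric_goldie_filter ::
  "('a, 'm) ring_scheme \<Rightarrow> ('a \<times> 'a \<Rightarrow>\<^sub>0 int) set set set"
  where "symmetric_goldie_filter R =
    symmetric_filter R (left_goldie_filter R) (right_goldie_filter R)"


section \<open>Derivations and differential filters\<close>

definition derivation :: "('a, 'm) ring_scheme \<Rightarrow> ('a \<Rightarrow> 'a) \<Rightarrow> bool"
  where "derivation R \<delta> \<longleftrightarrow>
    \<delta> \<in> carrier R \<rightarrow> carrier R \<and>
    (\<forall>r\<in>carrier R. \<forall>s\<in>carrier R. \<delta> (r \<oplus>\<^bsub>R\<^esub> s) = \<delta> r \<oplus>\<^bsub>R\<^esub> \<delta> s) \<and>
    (\<forall>r\<in>carrier R. \<forall>s\<in>carrier R. \<delta> (r \<otimes>\<^bsub>R\<^esub> s) = \<delta> r \<otimes>\<^bsub>R\<^esub> s \<oplus>\<^bsub>R\<^esub> r \<otimes>\<^bsub>R\<^esub> \<delta> s)"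

text \<open>
  The right ideal \<open>J\<close> may depend on the derivation.  Asking for one \<open>J\<close> that serves all derivations
  would, applied to inner derivations, force every member of the filter to contain a two-sided
  ideal belonging to the filter; for the first Weyl algebra over the rationals the dense right
  ideals, and the symmetric Lambek filter, do not have this property.
  The quantifier ranges over all derivations of the ring \<open>A\<close>.  For \<open>A = R \<otimes> R\<^sup>o\<^sup>p\<close> these include
  the derivations induced by those of \<open>R\<close>; see lemma \<open>induced_derivation\<close> below.
\<close>

definition differential_filter :: "('a, 'm) ring_scheme \<Rightarrow> 'a set set \<Rightarrow> bool"
  where "differential_filter A F \<longleftrightarrow>
    (\<forall>\<delta>. derivation A \<delta> \<longrightarrow> (\<forall>I\<in>F. \<exists>J\<in>F. \<delta> ` J \<subseteq> I))"


section \<open>Well-definedness\<close>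

lemma op_ring_simps [simp]:
  "carrier (op_ring R) = carrier R" "\<one>\<^bsub>op_ring R\<^esub> = \<one>\<^bsub>R\<^esub>" "\<zero>\<^bsub>op_ring R\<^esub> = \<zero>\<^bsub>R\<^esub>"
  "x \<oplus>\<^bsub>op_ring R\<^esub> y = x \<oplus>\<^bsub>R\<^esub> y" "x \<otimes>\<^bsub>op_ring R\<^esub> y = y \<otimes>\<^bsub>R\<^esub> x"
  by (simp_all add: op_ring_def)

lemma ring_op_ring: 
  assumes "ring R" 
  shows "ring (op_ring R)"
proof -
  interpret ring R by fact
  show ?thesis
  proof (rule ringI)
    show "abelian_group (op_ring R)"
      by (rule abelian_groupI) (use l_neg in \<open>auto simp: a_ac\<close>)
    show "Group.monoid (op_ring R)"
      by (rule monoidI) (auto simp: m_assoc)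
  qed (auto simp: l_distr r_distr)
qed

lemma derivation_op_ring: 
  assumes "ring R" "derivation R \<delta>" 
  shows "derivation (op_ring R) \<delta>"
proof -
  interpret ring R by fact
  show ?thesis
    using assms(2) by (auto simp: derivation_def Pi_iff intro!: a_comm)
qed

subsection \<open>The tensor product is a ring\<close>

lemma frag_extend_diff_fun: "frag_extend (\<lambda>p. f p - g p) x = frag_extend f x - frag_extend g x"
proof (rule frag_induction[where S = UNIV and c = x])
  fix x y
  assume "frag_extend (\<lambda>p. f p - g p) x = frag_extend f x - frag_extend g x"
    and "frag_extend (\<lambda>p. f p - g p) y = frag_extend f y - frag_extend g y"
  then show "frag_extend (\<lambda>p. f p - g p) (x - y) = frag_extend f (x - y) - frag_extend g (x - y)"
    by (simp only: frag_extend_diff) simp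
qed simp_all

lemma pair_mult_of: "pair_mult R S (frag_of (a, b)) (frag_of (c, d)) = frag_of (a \<otimes>\<^bsub>R\<^esub> c, b \<otimes>\<^bsub>S\<^esub> d)"
  by (simp add: pair_mult_def)

lemma pair_mult_0: "pair_mult R S 0 y = 0" "pair_mult R S x 0 = 0"
  by (simp_all add: pair_mult_def frag_extend_eq_0 split_def)

lemma pair_mult_diff:
  "pair_mult R S (x - x') y = pair_mult R S x y - pair_mult R S x' y"
  "pair_mult R S x (y - y') = pair_mult R S x y - pair_mult R S x y'"
  by (simp_all add: pair_mult_def frag_extend_diff frag_extend_diff_fun[symmetric] split_def)

lemma pair_mult_uminus:
  "pair_mult R S (- x) y = - pair_mult R S x y"
  "pair_mult R S x (- y) = - pair_mult R S x y"
  using pair_mult_diff(1)[of R S 0 x y] pair_mult_diff(2)[of R S x 0 y] 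
  by (simp_all add: pair_mult_0)

lemma pair_mult_add:
  "pair_mult R S (x + x') y = pair_mult R S x y + pair_mult R S x' y"
  "pair_mult R S x (y + y') = pair_mult R S x y + pair_mult R S x y'"
  using pair_mult_diff(1)[of R S x "- x'" y] pair_mult_diff(2)[of R S x y "- y'"]
  by (simp_all add: pair_mult_uminus)

lemma keys_diff_subset: 
  "\<lbrakk>Poly_Mapping.keys x \<subseteq> A; Poly_Mapping.keys y \<subseteq> A\<rbrakk> \<Longrightarrow> Poly_Mapping.keys (x - y) \<subseteq> A"
  using keys_diff[of x y] by blast

lemma keys_add_subset: 
  "\<lbrakk>Poly_Mapping.keys x \<subseteq> A; Poly_Mapping.keys y \<subseteq> A\<rbrakk> \<Longrightarrow> Poly_Mapping.keys (x + y) \<subseteq> A"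
  using Poly_Mapping.keys_add[of x y] by blast

lemma pair_ring_simps:
  "carrier (pair_ring R S) = {x. Poly_Mapping.keys x \<subseteq> carrier R \<times> carrier S}"
  "x \<otimes>\<^bsub>pair_ring R S\<^esub> y = pair_mult R S x y" "x \<oplus>\<^bsub>pair_ring R S\<^esub> y = x + y"
  "\<zero>\<^bsub>pair_ring R S\<^esub> = 0" "\<one>\<^bsub>pair_ring R S\<^esub> = frag_of (\<one>\<^bsub>R\<^esub>, \<one>\<^bsub>S\<^esub>)"
  by (auto simp: pair_ring_def)

locale two_rings = R: ring R + S: ring S 
  for R :: "('a, 'm) ring_scheme" and S :: "('b, 'n) ring_scheme"
begin

abbreviation "C \<equiv> carrier R \<times> carrier S"

lemma pair_mult_closed: 
  assumes "Poly_Mapping.keys x \<subseteq> C" "Poly_Mapping.keys y \<subseteq> C" 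
  shows "Poly_Mapping.keys (pair_mult R S x y) \<subseteq> C"
  using assms(1)
proof (induction x rule: frag_induction)
  case (one p)
  from assms(2) show ?case
    by (induction y rule: frag_induction)
       (use one in \<open>auto simp: pair_mult_0 pair_mult_diff pair_mult_of keys_frag_of 
         dest!: subsetD[OF keys_diff]\<close>)
qed (auto simp: pair_mult_0 pair_mult_diff dest!: subsetD[OF keys_diff])

lemma pair_mult_assoc: 
  assumes "Poly_Mapping.keys x \<subseteq> C" "Poly_Mapping.keys y \<subseteq> C" "Poly_Mapping.keys z \<subseteq> C" 
  shows "pair_mult R S (pair_mult R S x y) z = pair_mult R S x (pair_mult R S y z)"
  using assms(1)
proof (induction x rule: frag_induction)
  case (one p)
  from assms(2) show ?case
  proof (induction y rule: frag_induction)
    case (one q)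
    from assms(3) show ?case
      by (induction z rule: frag_induction)
         (use one \<open>p \<in> C\<close> in \<open>auto simp: pair_mult_0 pair_mult_diff pair_mult_of R.m_assoc S.m_assoc\<close>)
  qed (auto simp: pair_mult_0 pair_mult_diff)
qed (auto simp: pair_mult_0 pair_mult_diff)

lemma pair_mult_one: 
  assumes "Poly_Mapping.keys x \<subseteq> C"
  shows "pair_mult R S (frag_of (\<one>\<^bsub>R\<^esub>, \<one>\<^bsub>S\<^esub>)) x = x" "pair_mult R S x (frag_of (\<one>\<^bsub>R\<^esub>, \<one>\<^bsub>S\<^esub>)) = x"
  by (use assms in \<open>induction x rule: frag_induction\<close>)
     (auto simp: pair_mult_0 pair_mult_diff pair_mult_of)

lemma ring_pair_ring: "ring (pair_ring R S)"
proof (rule ringI)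
  show "abelian_group (pair_ring R S)"
  proof (rule abelian_groupI)
    fix x assume "x \<in> carrier (pair_ring R S)"
    then show "\<exists>y\<in>carrier (pair_ring R S). y \<oplus>\<^bsub>pair_ring R S\<^esub> x = \<zero>\<^bsub>pair_ring R S\<^esub>"
      by (intro bexI[of _ "- x"]) (auto simp: pair_ring_simps keys_minus)
  qed (auto simp: pair_ring_simps add_ac dest!: subsetD[OF Poly_Mapping.keys_add])
  show "Group.monoid (pair_ring R S)"
    by (rule monoidI) (simp_all add: pair_ring_simps pair_mult_closed pair_mult_assoc pair_mult_one
      keys_frag_of)
qed (simp_all add: pair_ring_simps pair_mult_add)

abbreviation "B \<equiv> bilinear_subgroup R S"

lemma bilinear_relations_keys: "bilinear_relations R S \<subseteq> {x. Poly_Mapping.keys x \<subseteq> C}"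
proof
  fix x assume "x \<in> bilinear_relations R S"
  then show "x \<in> {x. Poly_Mapping.keys x \<subseteq> C}"
    unfolding bilinear_relations_def
    by (elim UnE CollectE exE conjE; hypsubst) (intro CollectI keys_diff_subset; simp)+
qed

lemma bilinear_relations_carrier: "bilinear_relations R S \<subseteq> carrier (free_Abelian_group C)"
  using bilinear_relations_keys by (auto simp only: carrier_free_Abelian_group_iff)

lemma bilinear_subgroup_keys: "x \<in> B \<Longrightarrow> Poly_Mapping.keys x \<subseteq> C"
  using group.generate_in_carrier[OF group_free_Abelian_group bilinear_relations_carrier]
  by (simp add: bilinear_subgroup_def)

lemma bilinear_subgroup_zero: "0 \<in> B"
  using generate.one[of "free_Abelian_group C"] by (simp add: bilinear_subgroup_def)

lemma bilinear_subgroup_add: "x \<in> B \<Longrightarrow> y \<in> B \<Longrightarrow> x + y \<in> B"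
  using generate.eng[of x "free_Abelian_group C" _ y] by (simp add: bilinear_subgroup_def)

lemma bilinear_subgroup_incl: "x \<in> bilinear_relations R S \<Longrightarrow> x \<in> B"
  by (simp add: bilinear_subgroup_def generate.incl)

lemma bilinear_subgroup_uminus: 
  assumes "x \<in> B" shows "- x \<in> B"
proof -
  have "inv\<^bsub>free_Abelian_group C\<^esub> x \<in> B"
    using assms group.generate_m_inv_closed[OF group_free_Abelian_group bilinear_relations_carrier]
    by (simp add: bilinear_subgroup_def)
  then show ?thesis using bilinear_subgroup_keys[OF assms] by simp
qed

lemma bilinear_subgroup_diff: "x \<in> B \<Longrightarrow> y \<in> B \<Longrightarrow> x - y \<in> B"
  using bilinear_subgroup_add[of x "- y"] bilinear_subgroup_uminus[of y] by simp

lemma bilinear_subgroup_induct [consumes 1, case_names zero left right add uminus]: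
  assumes "x \<in> B" "P 0"
    and "\<And>a a' b. \<lbrakk>a \<in> carrier R; a' \<in> carrier R; b \<in> carrier S\<rbrakk> 
      \<Longrightarrow> P (frag_of (a \<oplus>\<^bsub>R\<^esub> a', b) - frag_of (a, b) - frag_of (a', b))"
    and "\<And>a b b'. \<lbrakk>a \<in> carrier R; b \<in> carrier S; b' \<in> carrier S\<rbrakk> 
      \<Longrightarrow> P (frag_of (a, b \<oplus>\<^bsub>S\<^esub> b') - frag_of (a, b) - frag_of (a, b'))"
    and "\<And>x y. \<lbrakk>P x; P y\<rbrakk> \<Longrightarrow> P (x + y)" 
    and um: "\<And>x. P x \<Longrightarrow> P (- x)"
  shows "P x"
proof -
  have rel: "P h" if "h \<in> bilinear_relations R S" for h
    using that assms(3,4) unfolding bilinear_relations_def by blast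
  show ?thesis
    using assms(1) unfolding bilinear_subgroup_def
  proof (induction rule: generate.induct)
    case (inv h)
    then have "Poly_Mapping.keys h \<subseteq> C" using bilinear_relations_keys by blast
    then show ?case using um[OF rel[OF inv]] by simp
  qed (use assms rel in auto)
qed

lemma bilinear_left: 
  "\<lbrakk>a \<in> carrier R; a' \<in> carrier R; b \<in> carrier S\<rbrakk> 
    \<Longrightarrow> frag_of (a \<oplus>\<^bsub>R\<^esub> a', b) - frag_of (a, b) - frag_of (a', b) \<in> B"
  by (rule bilinear_subgroup_incl) (auto simp: bilinear_relations_def)

lemma bilinear_right: 
  "\<lbrakk>a \<in> carrier R; b \<in> carrier S; b' \<in> carrier S\<rbrakk> 
    \<Longrightarrow> frag_of (a, b \<oplus>\<^bsub>S\<^esub> b') - frag_of (a, b) - frag_of (a, b') \<in> B"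
  by (rule bilinear_subgroup_incl) (auto simp: bilinear_relations_def)

lemma bilinear_subgroup_mult:
  assumes x: "Poly_Mapping.keys x \<subseteq> C" and y: "y \<in> B"
  shows "pair_mult R S x y \<in> B" "pair_mult R S y x \<in> B"
proof -
  have "pair_mult R S x y \<in> B \<and> pair_mult R S y x \<in> B"
    using x
  proof (induction x rule: frag_induction)
    case (one p)
    obtain c d where p: "p = (c, d)" and cd: "c \<in> carrier R" "d \<in> carrier S"
      using one by auto
    from y show ?case
    proof (induction rule: bilinear_subgroup_induct)
      case (left a a' b)
      then show ?case
        using cd bilinear_left[of "c \<otimes>\<^bsub>R\<^esub> a" "c \<otimes>\<^bsub>R\<^esub> a'" "d \<otimes>\<^bsub>S\<^esub> b"] 
          bilinear_left[of "a \<otimes>\<^bsub>R\<^esub> c" "a' \<otimes>\<^bsub>R\<^esub> c" "b \<otimes>\<^bsub>S\<^esub> d"] 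
        by (simp add: p pair_mult_diff pair_mult_of R.l_distr R.r_distr)
    next
      case (right a b b')
      then show ?case
        using cd bilinear_right[of "c \<otimes>\<^bsub>R\<^esub> a" "d \<otimes>\<^bsub>S\<^esub> b" "d \<otimes>\<^bsub>S\<^esub> b'"] 
          bilinear_right[of "a \<otimes>\<^bsub>R\<^esub> c" "b \<otimes>\<^bsub>S\<^esub> d" "b' \<otimes>\<^bsub>S\<^esub> d"]
        by (simp add: p pair_mult_diff pair_mult_of S.l_distr S.r_distr)
    qed (auto simp: pair_mult_0 pair_mult_add pair_mult_uminus 
        intro: bilinear_subgroup_zero bilinear_subgroup_add bilinear_subgroup_uminus)
  qed (auto simp: pair_mult_0 pair_mult_diff intro: bilinear_subgroup_zero bilinear_subgroup_diff)
  then show "pair_mult R S x y \<in> B" "pair_mult R S y x \<in> B" by auto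
qed

lemma ideal_bilinear_subgroup: "ideal B (pair_ring R S)"
proof (rule idealI[OF ring_pair_ring])
  interpret P: ring "pair_ring R S" by (rule ring_pair_ring)
  show "subgroup B (add_monoid (pair_ring R S))"
  proof (rule group.subgroupI[OF P.add.is_group])
    fix x assume "x \<in> B"
    then have "\<ominus>\<^bsub>pair_ring R S\<^esub> x = - x"
      using bilinear_subgroup_keys[of x]
      by (intro P.minus_equality) (auto simp: pair_ring_simps keys_minus)
    then show "inv\<^bsub>add_monoid (pair_ring R S)\<^esub> x \<in> B"
      using \<open>x \<in> B\<close> by (simp add: a_inv_def bilinear_subgroup_uminus)
  qed (use bilinear_subgroup_keys bilinear_subgroup_zero in 
      \<open>auto simp: pair_ring_simps intro: bilinear_subgroup_add\<close>)
qed (simp_all add: pair_ring_simps bilinear_subgroup_mult)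

theorem ring_tensor_ring: "ring (tensor_ring R S)"
  unfolding tensor_ring_def by (rule ideal.quotient_is_ring[OF ideal_bilinear_subgroup])

subsection \<open>Induced derivations\<close>

abbreviation "cl \<equiv> \<lambda>x. B +>\<^bsub>pair_ring R S\<^esub> x"

lemma cl_carrier: "Poly_Mapping.keys x \<subseteq> C \<Longrightarrow> cl x \<in> carrier (tensor_ring R S)"
  using ring_hom_closed[OF ideal.rcos_ring_hom[OF ideal_bilinear_subgroup]]
  by (simp add: tensor_ring_def pair_ring_simps)

lemma cl_mult: 
  "\<lbrakk>Poly_Mapping.keys x \<subseteq> C; Poly_Mapping.keys y \<subseteq> C\<rbrakk> \<Longrightarrow> 
    cl x \<otimes>\<^bsub>tensor_ring R S\<^esub> cl y = cl (pair_mult R S x y)"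
  using ring_hom_mult[OF ideal.rcos_ring_hom[OF ideal_bilinear_subgroup], of x y]
  by (simp add: tensor_ring_def pair_ring_simps)

lemma cl_add: 
  "\<lbrakk>Poly_Mapping.keys x \<subseteq> C; Poly_Mapping.keys y \<subseteq> C\<rbrakk> \<Longrightarrow> 
    cl x \<oplus>\<^bsub>tensor_ring R S\<^esub> cl y = cl (x + y)"
  using ring_hom_add[OF ideal.rcos_ring_hom[OF ideal_bilinear_subgroup], of x y]
  by (simp add: tensor_ring_def pair_ring_simps)

lemma cl_eq:
  assumes "x - y \<in> B"
  shows "cl x = cl y"
proof -
  have 1: "b + x \<in> cl y" if "b \<in> B" "x - y \<in> B" for b x y
    using that bilinear_subgroup_add[of b "x - y"] 
    by (auto simp: a_r_coset_def' pair_ring_simps intro!: bexI[of _ "b + (x - y)"])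
  have "y - x \<in> B" using bilinear_subgroup_uminus[OF assms] by simp
  with assms 1 show ?thesis 
    by (auto simp: a_r_coset_def'[of _ _ x] a_r_coset_def'[of _ _ y] pair_ring_simps simp del: add_uminus_conv_diff
      dest: 1[of _ x y] 1[of _ y x])
qed

lemma carrier_tensor: 
  assumes "X \<in> carrier (tensor_ring R S)"
  obtains x where "Poly_Mapping.keys x \<subseteq> C" "X = cl x"
  using assms
  by (auto simp: tensor_ring_def FactRing_def A_RCOSETS_def' pair_ring_simps)

lemma mem_cl: "Poly_Mapping.keys x \<subseteq> C \<Longrightarrow> x \<in> cl x" "y \<in> cl x \<Longrightarrow> y - x \<in> B"
  using bilinear_subgroup_zero by (auto simp: a_r_coset_def' pair_ring_simps)

lemma tensor_derivation:
  assumes d: "derivation R \<delta>" and e: "derivation S \<epsilon>"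
  obtains D where "derivation (tensor_ring R S) D"
    "\<And>a b. \<lbrakk>a \<in> carrier R; b \<in> carrier S\<rbrakk> \<Longrightarrow> D (pure_tensor R S a b) =
      pure_tensor R S (\<delta> a) b \<oplus>\<^bsub>tensor_ring R S\<^esub> pure_tensor R S a (\<epsilon> b)"
proof -
  have dc: "\<delta> a \<in> carrier R" if "a \<in> carrier R" for a using d that by (auto simp: derivation_def)
  have ec: "\<epsilon> a \<in> carrier S" if "a \<in> carrier S" for a using e that by (auto simp: derivation_def)
  have d1: "\<delta> (a \<oplus>\<^bsub>R\<^esub> b) = \<delta> a \<oplus>\<^bsub>R\<^esub> \<delta> b" if "a \<in> carrier R" "b \<in> carrier R" for a b 
    using d that by (auto simp: derivation_def)
  have e1: "\<epsilon> (a \<oplus>\<^bsub>S\<^esub> b) = \<epsilon> a \<oplus>\<^bsub>S\<^esub> \<epsilon> b" if "a \<in> carrier S" "b \<in> carrier S" for a b 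
    using e that by (auto simp: derivation_def)
  have d2: "\<delta> (a \<otimes>\<^bsub>R\<^esub> b) = \<delta> a \<otimes>\<^bsub>R\<^esub> b \<oplus>\<^bsub>R\<^esub> a \<otimes>\<^bsub>R\<^esub> \<delta> b" if "a \<in> carrier R" "b \<in> carrier R" for a b 
    using d that by (auto simp: derivation_def)
  have e2: "\<epsilon> (a \<otimes>\<^bsub>S\<^esub> b) = \<epsilon> a \<otimes>\<^bsub>S\<^esub> b \<oplus>\<^bsub>S\<^esub> a \<otimes>\<^bsub>S\<^esub> \<epsilon> b" if "a \<in> carrier S" "b \<in> carrier S" for a b 
    using e that by (auto simp: derivation_def)
  define \<Delta> where "\<Delta> = frag_extend (\<lambda>(a, b). frag_of (\<delta> a, b) + frag_of (a, \<epsilon> b))"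
  have D_of: "\<Delta> (frag_of (a, b)) = frag_of (\<delta> a, b) + frag_of (a, \<epsilon> b)" for a b
    by (simp add: \<Delta>_def)
  have D_0: "\<Delta> 0 = 0" and D_diff: "\<And>x y. \<Delta> (x - y) = \<Delta> x - \<Delta> y" 
    and D_add: "\<And>x y. \<Delta> (x + y) = \<Delta> x + \<Delta> y" and D_minus: "\<And>x. \<Delta> (- x) = - \<Delta> x"
    by (simp_all add: \<Delta>_def frag_extend_diff frag_extend_add frag_extend_minus)
  have D_closed: "Poly_Mapping.keys (\<Delta> x) \<subseteq> C" if "Poly_Mapping.keys x \<subseteq> C" for x
    using that
  proof (induction x rule: frag_induction)
    case (one p)
    then obtain a b where "p = (a, b)" "a \<in> carrier R" "b \<in> carrier S" by auto
    then show ?case by (simp add: D_of) (rule keys_add_subset; simp add: dc ec)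
  next
    case (diff x y)
    then show ?case by (simp add: D_diff keys_diff_subset)
  qed (simp add: D_0)
  have D_B: "\<Delta> x \<in> B" if "x \<in> B" for x
    using that
  proof (induction rule: bilinear_subgroup_induct)
    case (left a a' b)
    have "(frag_of (\<delta> a \<oplus>\<^bsub>R\<^esub> \<delta> a', b) - frag_of (\<delta> a, b) - frag_of (\<delta> a', b)) +
      (frag_of (a \<oplus>\<^bsub>R\<^esub> a', \<epsilon> b) - frag_of (a, \<epsilon> b) - frag_of (a', \<epsilon> b)) \<in> B"
      using left by (intro bilinear_subgroup_add bilinear_left dc ec) auto
    then show ?case using left by (simp add: D_diff D_add D_of d1 algebra_simps)
  next
    case (right a b b')
    have "(frag_of (\<delta> a, b \<oplus>\<^bsub>S\<^esub> b') - frag_of (\<delta> a, b) - frag_of (\<delta> a, b')) +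
      (frag_of (a, \<epsilon> b \<oplus>\<^bsub>S\<^esub> \<epsilon> b') - frag_of (a, \<epsilon> b) - frag_of (a, \<epsilon> b')) \<in> B"
      using right by (intro bilinear_subgroup_add bilinear_right dc ec) auto
    then show ?case using right by (simp add: D_diff D_add D_of e1 algebra_simps)
  qed (auto simp: D_0 D_add D_minus intro: bilinear_subgroup_zero bilinear_subgroup_add 
      bilinear_subgroup_uminus)
  have D_mult: "\<Delta> (pair_mult R S x y) - (pair_mult R S (\<Delta> x) y + pair_mult R S x (\<Delta> y)) \<in> B" 
    (is "?L x y \<in> B") if "Poly_Mapping.keys x \<subseteq> C" "Poly_Mapping.keys y \<subseteq> C" for x y
    using that(1)
  proof (induction x rule: frag_induction)
    case (one p)
    obtain a b where p: "p = (a, b)" and ab: "a \<in> carrier R" "b \<in> carrier S"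
      using one by auto
    from that(2) show ?case
    proof (induction y rule: frag_induction)
      case (one q)
      obtain c d where q: "q = (c, d)" and cd: "c \<in> carrier R" "d \<in> carrier S"
        using one by auto
      have "(frag_of (\<delta> a \<otimes>\<^bsub>R\<^esub> c \<oplus>\<^bsub>R\<^esub> a \<otimes>\<^bsub>R\<^esub> \<delta> c, b \<otimes>\<^bsub>S\<^esub> d) - frag_of (\<delta> a \<otimes>\<^bsub>R\<^esub> c, b \<otimes>\<^bsub>S\<^esub> d) - 
          frag_of (a \<otimes>\<^bsub>R\<^esub> \<delta> c, b \<otimes>\<^bsub>S\<^esub> d)) +
        (frag_of (a \<otimes>\<^bsub>R\<^esub> c, \<epsilon> b \<otimes>\<^bsub>S\<^esub> d \<oplus>\<^bsub>S\<^esub> b \<otimes>\<^bsub>S\<^esub> \<epsilon> d) - frag_of (a \<otimes>\<^bsub>R\<^esub> c, \<epsilon> b \<otimes>\<^bsub>S\<^esub> d) - 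
          frag_of (a \<otimes>\<^bsub>R\<^esub> c, b \<otimes>\<^bsub>S\<^esub> \<epsilon> d)) \<in> B"
        using ab cd by (intro bilinear_subgroup_add bilinear_left bilinear_right) (auto simp: dc ec)
      then show ?case
        using ab cd by (simp add: p q D_of pair_mult_of pair_mult_add d2 e2 algebra_simps)
    next
      case (diff y z)
      have "?L (frag_of p) (y - z) = ?L (frag_of p) y - ?L (frag_of p) z"
        by (simp add: D_diff pair_mult_diff)
      then show ?case using bilinear_subgroup_diff[OF diff] by simp
    qed (simp add: pair_mult_0 D_0 bilinear_subgroup_zero)
  next
    case (diff x z)
    have "?L (x - z) y = ?L x y - ?L z y"
      by (simp add: D_diff pair_mult_diff)
    then show ?case using bilinear_subgroup_diff[OF diff] by simp
  qed (simp add: pair_mult_0 D_0 bilinear_subgroup_zero)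
  define D where "D X = cl (\<Delta> (SOME x. x \<in> X))" for X
  have D_cl: "D (cl x) = cl (\<Delta> x)" if "Poly_Mapping.keys x \<subseteq> C" for x
  proof -
    have "(SOME y. y \<in> cl x) \<in> cl x" by (rule someI[of "\<lambda>y. y \<in> cl x", OF mem_cl(1)[OF that]])
    then have "(SOME y. y \<in> cl x) - x \<in> B" by (rule mem_cl)
    then show ?thesis using D_B[of "(SOME y. y \<in> cl x) - x"] 
      by (simp add: D_def D_diff cl_eq)
  qed
  have "derivation (tensor_ring R S) D"
    unfolding derivation_def
  proof (intro conjI ballI)
    show "D \<in> carrier (tensor_ring R S) \<rightarrow> carrier (tensor_ring R S)"
      by (auto elim!: carrier_tensor simp: D_cl cl_carrier D_closed)
    fix X Y assume "X \<in> carrier (tensor_ring R S)" "Y \<in> carrier (tensor_ring R S)"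
    then obtain x y where x: "Poly_Mapping.keys x \<subseteq> C" "X = cl x" 
      and y: "Poly_Mapping.keys y \<subseteq> C" "Y = cl y" by (metis carrier_tensor)
    show "D (X \<oplus>\<^bsub>tensor_ring R S\<^esub> Y) = D X \<oplus>\<^bsub>tensor_ring R S\<^esub> D Y"
      using x(1) y(1) by (simp add: x(2) y(2) D_cl cl_add D_closed D_add keys_add_subset)
    show "D (X \<otimes>\<^bsub>tensor_ring R S\<^esub> Y) 
      = D X \<otimes>\<^bsub>tensor_ring R S\<^esub> Y \<oplus>\<^bsub>tensor_ring R S\<^esub> X \<otimes>\<^bsub>tensor_ring R S\<^esub> D Y"
      using x(1) y(1) cl_eq[OF D_mult[OF x(1) y(1)]]
      by (simp add: x(2) y(2) D_cl cl_mult cl_add D_closed pair_mult_closed)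
  qed
  moreover have "D (pure_tensor R S a b) = 
      pure_tensor R S (\<delta> a) b \<oplus>\<^bsub>tensor_ring R S\<^esub> pure_tensor R S a (\<epsilon> b)"
    if "a \<in> carrier R" "b \<in> carrier S" for a b
    using that by (simp add: pure_tensor_def D_cl keys_frag_of cl_add dc ec D_of)
  ultimately show thesis by (rule that)
qed

end

theorem ring_enveloping_ring: 
  assumes "ring R" 
  shows "ring (enveloping_ring R)"
  by (rule two_rings.ring_tensor_ring) (simp add: two_rings_def assms ring_op_ring)

theorem induced_derivation:
  assumes "ring R" "derivation R \<delta>"
  shows "\<exists>D. derivation (enveloping_ring R) D \<and>
    (\<forall>r\<in>carrier R. \<forall>s\<in>carrier R. D (pure_tensor R (op_ring R) r s) =
      pure_tensor R (op_ring R) (\<delta> r) s \<oplus>\<^bsub>enveloping_ring R\<^esub> pure_tensor R (op_ring R) r (\<delta> s))"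
proof -
  interpret two_rings R "op_ring R" by (simp add: two_rings_def assms ring_op_ring)
  show ?thesis
    by (rule tensor_derivation[OF assms(2) derivation_op_ring[OF assms]]) auto
qed

subsection \<open>Cyclic modules suffice for the Goldie filter\<close>

context ring
begin

context
  fixes I
  assumes I: "right_ideal R I"
begin

lemma right_ideal_abelian_subgroup: "abelian_subgroup I R"
  using I by (intro abelian_subgroupI3 abelian_group_axioms) (simp add: right_ideal_def)

interpretation I: abelian_subgroup I R
  by (rule right_ideal_abelian_subgroup)

lemma right_ideal_mult: "\<lbrakk>a \<in> I; r \<in> carrier R\<rbrakk> \<Longrightarrow> a \<otimes> r \<in> I"
  using I by (simp add: right_ideal_def)

lemma carrier_quotient_module: "carrier (quotient_module R I) = {I +> x | x. x \<in> carrier R}"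
  by (auto simp: quotient_module_def A_RCOSETS_def')

lemma quotient_module_add: 
  "\<lbrakk>x \<in> carrier R; y \<in> carrier R\<rbrakk> \<Longrightarrow> 
    (I +> x) \<oplus>\<^bsub>quotient_module R I\<^esub> (I +> y) = I +> (x \<oplus> y)"
  by (simp add: quotient_module_def I.a_rcos_sum)

lemma quotient_module_zero: "\<zero>\<^bsub>quotient_module R I\<^esub> = I"
  by (simp add: quotient_module_def)

lemma coset_eq_iff: "x \<in> carrier R \<Longrightarrow> I +> x = I \<longleftrightarrow> x \<in> I"
  by (metis I.a_rcos_const I.a_rcos_self)

lemma UN_coset:
  assumes x: "x \<in> carrier R" and F: "\<And>i. i \<in> I \<Longrightarrow> F (i \<oplus> x) = F x"
  shows "(\<Union>y\<in>I +> x. F y) = F x"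
proof -
  have "I \<noteq> {}" using subgroup.one_closed[OF I.a_subgroup] by blast
  then show ?thesis using F by (auto simp: a_r_coset_def')
qed

lemma quotient_module_smult:
  assumes "x \<in> carrier R" "r \<in> carrier R"
  shows "r \<odot>\<^bsub>quotient_module R I\<^esub> (I +> x) = I +> (x \<otimes> r)"
proof -
  have "I +> ((i \<oplus> x) \<otimes> r) = I +> (x \<otimes> r)" if "i \<in> I" for i
  proof -
    have i: "i \<in> carrier R" using that I.a_subset by blast
    have "I +> ((i \<oplus> x) \<otimes> r) = set_add R (I +> (i \<otimes> r)) (I +> (x \<otimes> r))"
      using assms i by (simp add: I.a_rcos_sum l_distr)
    also have "I +> (i \<otimes> r) = I +> \<zero>"
      using that assms i by (simp add: right_ideal_mult I.a_rcos_const a_coset_add_zero I.a_subset)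
    finally show ?thesis using assms by (simp add: I.a_rcos_sum)
  qed
  then show ?thesis
    using UN_coset[OF assms(1), of "\<lambda>y. I +> (y \<otimes> r)"] by (simp add: quotient_module_def)
qed

lemma right_module_quotient: "right_module R (quotient_module R I)"
proof -
  note simps = carrier_quotient_module quotient_module_add quotient_module_smult
  have zero: "I +> \<zero> = \<zero>\<^bsub>quotient_module R I\<^esub>"
    by (simp add: quotient_module_zero I.a_subset)
  have "abelian_group (quotient_module R I)"
  proof (rule abelian_groupI)
    fix X assume "X \<in> carrier (quotient_module R I)"
    then obtain x where "x \<in> carrier R" "X = I +> x" by (auto simp: simps)
    then show "\<exists>Y\<in>carrier (quotient_module R I).
        Y \<oplus>\<^bsub>quotient_module R I\<^esub> X = \<zero>\<^bsub>quotient_module R I\<^esub>"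
      by (intro bexI[of _ "I +> (\<ominus> x)"])
         (auto simp: simps zero[symmetric] l_neg)
  qed (auto simp: simps zero[symmetric] a_ac)
  then show ?thesis
    by (intro right_module.intro right_module_axioms.intro ring_axioms)
       (auto simp: simps l_distr r_distr m_assoc)
qed

end

theorem right_goldie_filter_hom_trivial:
  fixes N :: "('a, 'c) module"
  assumes I: "I \<in> right_goldie_filter R" and N: "N \<in> nonsingular_modules R"
    and f: "f \<in> right_module_hom R (quotient_module R I) N"
    and X: "X \<in> carrier (quotient_module R I)"
  shows "f X = \<zero>\<^bsub>N\<^esub>"
proof -
  interpret N: right_module R N
    using N by (simp add: nonsingular_modules_def)
  have rI: "right_ideal R I" using I by (simp add: right_goldie_filter_def torsion_filter_def)
  interpret I: abelian_subgroup I R by (rule right_ideal_abelian_subgroup[OF rI])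
  note simpsI = carrier_quotient_module[OF rI] quotient_module_add[OF rI] 
    quotient_module_smult[OF rI]
  define h where "h x = f (I +> x)" for x
  have h: "h x \<in> carrier N" if "x \<in> carrier R" for x
    using f that by (auto simp: h_def right_module_hom_def simpsI)
  have h_add: "h (x \<oplus> y) = h x \<oplus>\<^bsub>N\<^esub> h y" if "x \<in> carrier R" "y \<in> carrier R" for x y
  proof -
    have "I +> x \<in> carrier (quotient_module R I)" "I +> y \<in> carrier (quotient_module R I)"
      using that by (auto simp: simpsI)
    then show ?thesis using f that by (auto simp: h_def right_module_hom_def simpsI(2)[symmetric])
  qed
  have h_mult: "h (x \<otimes> r) = r \<odot>\<^bsub>N\<^esub> h x" if "x \<in> carrier R" "r \<in> carrier R" for x r
  proof -
    have "I +> x \<in> carrier (quotient_module R I)"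
      using that by (auto simp: simpsI)
    then show ?thesis using f that by (auto simp: h_def right_module_hom_def simpsI(3)[symmetric])
  qed
  have N0: "r \<odot>\<^bsub>N\<^esub> \<zero>\<^bsub>N\<^esub> = \<zero>\<^bsub>N\<^esub>" if "r \<in> carrier R" for r
  proof -
    have "r \<odot>\<^bsub>N\<^esub> \<zero>\<^bsub>N\<^esub> \<oplus>\<^bsub>N\<^esub> r \<odot>\<^bsub>N\<^esub> \<zero>\<^bsub>N\<^esub> = r \<odot>\<^bsub>N\<^esub> \<zero>\<^bsub>N\<^esub>"
      using N.rsmult_distrib_module[OF that, of "\<zero>\<^bsub>N\<^esub>" "\<zero>\<^bsub>N\<^esub>"] by simp
    then show ?thesis using that by (simp add: N.rsmult_closed)
  qed
  interpret h: group_hom "add_monoid R" "add_monoid N" h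
    using h h_add N.M.a_group a_group by unfold_locales (auto simp: hom_def)
  define K where "K = {x \<in> carrier R. h x = \<zero>\<^bsub>N\<^esub>}"
  have "subgroup K (add_monoid R)"
    using h.subgroup_kernel by (simp add: kernel_def K_def)
  then have rK: "right_ideal R K"
    unfolding right_ideal_def
    by (intro conjI additive_subgroupI) (auto simp: K_def h_mult N0)
  interpret K: abelian_subgroup K R by (rule right_ideal_abelian_subgroup[OF rK])
  note simpsK = carrier_quotient_module[OF rK] quotient_module_add[OF rK] 
    quotient_module_smult[OF rK] quotient_module_zero[OF rK]
  have hz: "h \<zero> = \<zero>\<^bsub>N\<^esub>" using h.hom_one by simp
  have IK: "I \<subseteq> K"
  proof
    fix i assume i: "i \<in> I"
    then have "I +> i = I +> \<zero>" using I.a_subset by (simp add: I.a_rcos_const a_coset_add_zero)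
    then have "h i = h \<zero>" by (simp only: h_def)
    then have "h i = \<zero>\<^bsub>N\<^esub>" by (rule trans[OF _ hz])
    then show "i \<in> K" unfolding K_def using i I.a_subset by blast
  qed
  define g where "g Y = (\<Union>y\<in>Y. K +> y)" for Y
  have g: "g (I +> x) = K +> x" if x: "x \<in> carrier R" for x
    unfolding g_def
  proof (rule UN_coset[OF rI x])
    fix i assume "i \<in> I"
    then have i: "i \<in> K" "i \<in> carrier R" using IK I.a_subset by auto
    have "K +> (i \<oplus> x) = set_add R (K +> i) (K +> x)" using i x by (simp add: K.a_rcos_sum)
    also have "K +> i = K +> \<zero>" using i by (simp add: K.a_rcos_const a_coset_add_zero K.a_subset)
    finally show "K +> (i \<oplus> x) = K +> x" using x by (simp add: K.a_rcos_sum)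
  qed
  have ghom: "g \<in> right_module_hom R (quotient_module R I) (quotient_module R K)"
    unfolding right_module_hom_def by (auto simp: simpsI simpsK g)
  have ann: "annihilator R (quotient_module R K) (K +> x) = annihilator R N (h x)" 
    if x: "x \<in> carrier R" for x
  proof -
    have "r \<odot>\<^bsub>quotient_module R K\<^esub> (K +> x) = \<zero>\<^bsub>quotient_module R K\<^esub> \<longleftrightarrow> r \<odot>\<^bsub>N\<^esub> h x = \<zero>\<^bsub>N\<^esub>" 
      if r: "r \<in> carrier R" for r
    proof -
      have "K +> (x \<otimes> r) = K \<longleftrightarrow> x \<otimes> r \<in> K" by (rule coset_eq_iff[OF rK m_closed[OF x r]])
      also have "\<dots> \<longleftrightarrow> h (x \<otimes> r) = \<zero>\<^bsub>N\<^esub>" using m_closed[OF x r] by (auto simp only: K_def)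
      finally show ?thesis by (simp only: simpsK(3)[OF x r] simpsK(4) h_mult[OF x r])
    qed
    then show ?thesis unfolding annihilator_def by blast
  qed
  have "essential_right_ideal R (carrier R)"
    unfolding essential_right_ideal_def
  proof (intro conjI allI impI)
    show "right_ideal R (carrier R)"
      unfolding right_ideal_def 
      by (auto intro!: additive_subgroupI add.subgroup_self)
    fix L assume "right_ideal R L \<and> L \<noteq> {\<zero>}"
    moreover from this have "L \<subseteq> carrier R"
      using additive_subgroup.a_subset by (auto simp: right_ideal_def)
    ultimately show "carrier R \<inter> L \<noteq> {\<zero>}" by (simp add: Int_absorb1)
  qed
  moreover have "annihilator R (quotient_module R K) (K +> \<zero>) = carrier R"
  proof -
    have "\<zero> \<in> carrier R" by simp
    from ann[OF this] show ?thesis using N0 by (auto simp only: hz annihilator_def)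
  qed
  ultimately have 0: "K +> \<zero> \<in> singular_submodule R (quotient_module R K)"
    by (auto simp: singular_submodule_def simpsK)
  have only: "Y = K" if Y: "Y \<in> singular_submodule R (quotient_module R K)" for Y
  proof -
    from Y obtain x where x: "x \<in> carrier R" "Y = K +> x" 
      by (auto simp: singular_submodule_def simpsK)
    with Y have "essential_right_ideal R (annihilator R N (h x))"
      by (simp add: singular_submodule_def ann)
    with x have "h x \<in> singular_submodule R N" by (simp add: singular_submodule_def h)
    moreover have "singular_submodule R N = {\<zero>\<^bsub>N\<^esub>}"
      using N unfolding nonsingular_modules_def by blast
    ultimately have "x \<in> K" using x(1) unfolding K_def by blast
    with x show ?thesis by (simp add: coset_eq_iff[OF rK])
  qed
  have "singular_submodule R (quotient_module R K) = {\<zero>\<^bsub>quotient_module R K\<^esub>}"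
    unfolding simpsK(4) using only 0[unfolded only[OF 0]] by blast
  then have "quotient_module R K \<in> nonsingular_modules R"
    using right_module_quotient[OF rK] by (simp add: nonsingular_modules_def)
  with I ghom X have "g X = \<zero>\<^bsub>quotient_module R K\<^esub>"
    unfolding right_goldie_filter_def torsion_filter_def torsion_class_def by blast
  then have gX: "g X = K" by (simp only: simpsK(4))
  from X obtain x where x: "x \<in> carrier R" "X = I +> x" by (auto simp: simpsI)
  with gX have "x \<in> K" by (simp add: g coset_eq_iff[OF rK])
  then show ?thesis unfolding x(2) K_def h_def by blast
qed

end

end

theory Submission
  imports Defs
begin

text \<open>
  Every Gabriel filter is differential: if \<open>I\<close> belongs to the filter and \<open>\<delta>\<close> is a derivation, then
  \<open>J = {a \<in> I. \<delta> a \<in> I}\<close> is a right ideal and, by Leibniz' rule, \<open>(J : a) = (I : \<delta> a)\<close> for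
  \<open>a \<in> I\<close>, so \<open>J\<close> belongs to the filter.  A symmetric filter is the intersection of the filters
  obtained by restriction of scalars along \<open>r \<mapsto> r \<otimes> 1\<close> and \<open>s \<mapsto> 1 \<otimes> s\<close>, hence it is Gabriel
  if both one-sided filters are.  The dense right ideals form a Gabriel filter by direct
  computation.  For the Goldie filter, write \<open>Z(I)/I\<close> for the singular submodule of \<open>R/I\<close>;
  then \<open>I\<close> belongs to the filter iff \<open>Z(I)\<close> is essential, because \<open>R/Z(Z(I))\<close> is nonsingular.
\<close>

section \<open>Gabriel filters\<close>

text \<open>The ideal \<open>(I : a)\<close>; for a right ideal \<open>I\<close> it is the
  annihilator of the coset of \<open>a\<close> in \<open>R/I\<close>.\<close>

definition colon :: "('a, 'm) ring_scheme \<Rightarrow> 'a set \<Rightarrow> 'a \<Rightarrow> 'a set"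
  where "colon R I a = {r \<in> carrier R. a \<otimes>\<^bsub>R\<^esub> r \<in> I}"

text \<open>
  In \<open>gabriel_transitive\<close> the right ideal \<open>J\<close> need not be contained in \<open>I\<close>, so that closure under
  supersets and finite intersections follows.
\<close>

locale gabriel_filter = ring R for R :: "('a, 'm) ring_scheme" (structure) +
  fixes F :: "'a set set"
  assumes gabriel_right_ideal: "I \<in> F \<Longrightarrow> right_ideal R I"
    and gabriel_carrier: "carrier R \<in> F"
    and gabriel_colon: "\<lbrakk>I \<in> F; a \<in> carrier R\<rbrakk> \<Longrightarrow> colon R I a \<in> F"
    and gabriel_transitive:
      "\<lbrakk>I \<in> F; right_ideal R J; \<And>a. a \<in> I \<Longrightarrow> colon R J a \<in> F\<rbrakk> \<Longrightarrow> J \<in> F"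

section \<open>Right ideals and colon ideals\<close>

context ring
begin

lemma right_idealD:
  assumes "right_ideal R I"
  shows "I \<subseteq> carrier R" "\<zero> \<in> I" "\<lbrakk>a \<in> I; b \<in> I\<rbrakk> \<Longrightarrow> a \<oplus> b \<in> I"
    "a \<in> I \<Longrightarrow> \<ominus> a \<in> I" "\<lbrakk>a \<in> I; r \<in> carrier R\<rbrakk> \<Longrightarrow> a \<otimes> r \<in> I"
proof -
  interpret additive_subgroup I R using assms by (simp add: right_ideal_def)
  show "I \<subseteq> carrier R" "\<zero> \<in> I" "\<lbrakk>a \<in> I; b \<in> I\<rbrakk> \<Longrightarrow> a \<oplus> b \<in> I" "a \<in> I \<Longrightarrow> \<ominus> a \<in> I"
    using a_inv_closed abelian_group_axioms by (auto simp: a_subset)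
  show "\<lbrakk>a \<in> I; r \<in> carrier R\<rbrakk> \<Longrightarrow> a \<otimes> r \<in> I"
    using assms by (simp add: right_ideal_def)
qed

lemma right_ideal_memD: "\<lbrakk>right_ideal R I; a \<in> I\<rbrakk> \<Longrightarrow> a \<in> carrier R"
  using right_idealD(1) by blast

text \<open>Closure under negation comes from right multiplication, as
  \<open>\<ominus> a = a \<otimes> (\<ominus> \<one>)\<close>.\<close>

lemma right_idealI:
  assumes "I \<subseteq> carrier R" "\<zero> \<in> I" and add: "\<And>a b. \<lbrakk>a \<in> I; b \<in> I\<rbrakk> \<Longrightarrow> a \<oplus> b \<in> I"
    and mult: "\<And>a r. \<lbrakk>a \<in> I; r \<in> carrier R\<rbrakk> \<Longrightarrow> a \<otimes> r \<in> I"
  shows "right_ideal R I"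
  unfolding right_ideal_def
proof (intro conjI ballI additive_subgroupI mult)
  have "\<ominus> a \<in> I" if "a \<in> I" for a
  proof -
    have "a \<in> carrier R" using that assms(1) by blast
    then have "a \<otimes> (\<ominus> \<one>) = \<ominus> a" by (simp add: r_minus)
    then show ?thesis using mult[OF that, of "\<ominus> \<one>"] by simp
  qed
  then show "subgroup I (add_monoid R)"
    using assms by (intro add.subgroupI) (auto simp: a_inv_def)
qed

lemma right_ideal_carrier: "right_ideal R (carrier R)"
  by (rule right_idealI) auto

lemma right_ideal_colon:
  assumes "right_ideal R I" "a \<in> carrier R"
  shows "right_ideal R (colon R I a)"
  using assms by (intro right_idealI)
    (auto simp: colon_def r_distr m_assoc[symmetric] right_idealD(2-5))

lemma colon_mem_eq_carrier: "\<lbrakk>right_ideal R I; a \<in> I\<rbrakk> \<Longrightarrow> colon R I a = carrier R"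
  by (auto simp: colon_def right_idealD)

lemma colon_colon:
  "\<lbrakk>right_ideal R I; a \<in> carrier R; b \<in> carrier R\<rbrakk> \<Longrightarrow> colon R (colon R I a) b = colon R I (a \<otimes> b)"
  by (auto simp: colon_def m_assoc)

lemma colon_one: "right_ideal R I \<Longrightarrow> colon R I \<one> = I"
  by (auto simp: colon_def dest: right_ideal_memD)

end

section \<open>Closure properties of Gabriel filters, and derivations\<close>

context gabriel_filter
begin

text \<open>For \<open>a\<close> in \<open>I\<close> the ideal \<open>(J : a)\<close> is all of
  \<open>R\<close>, so transitivity applies at once.\<close>

lemma gabriel_superset:
  assumes "I \<in> F" "right_ideal R J" "I \<subseteq> J"
  shows "J \<in> F"
proof (rule gabriel_transitive[OF assms(1,2)])
  fix a assume "a \<in> I"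
  then have "colon R J a = carrier R" using assms(2,3) by (auto intro!: colon_mem_eq_carrier)
  then show "colon R J a \<in> F" using gabriel_carrier by simp
qed

text \<open>For \<open>a\<close> in \<open>I\<close>, \<open>(I \<inter> J : a) = (J : a)\<close>,
  which lies in \<open>F\<close>.\<close>

lemma gabriel_Int:
  assumes "I \<in> F" "J \<in> F"
  shows "I \<inter> J \<in> F"
proof (rule gabriel_transitive[OF assms(1)])
  note r = gabriel_right_ideal[OF assms(1)] gabriel_right_ideal[OF assms(2)]
  show "right_ideal R (I \<inter> J)"
    using r by (intro right_idealI) (auto simp: right_idealD dest: right_ideal_memD)
  fix a assume a: "a \<in> I"
  then have "colon R (I \<inter> J) a = colon R J a" using r by (auto simp: colon_def right_idealD)
  then show "colon R (I \<inter> J) a \<in> F"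
    using gabriel_colon[OF assms(2)] right_ideal_memD[OF r(1) a] by simp
qed

theorem differential_filter_gabriel: "differential_filter R F"
  unfolding differential_filter_def
proof (intro allI impI ballI)
  fix \<delta> I assume d: "derivation R \<delta>" and I: "I \<in> F"
  have rI: "right_ideal R I" using gabriel_right_ideal[OF I] .
  have dc: "\<delta> a \<in> carrier R" if "a \<in> carrier R" for a
    using d that by (auto simp: derivation_def)
  have d_add: "\<delta> (a \<oplus> b) = \<delta> a \<oplus> \<delta> b" if "a \<in> carrier R" "b \<in> carrier R" for a b
    using d that by (auto simp: derivation_def)
  have d_mult: "\<delta> (a \<otimes> b) = \<delta> a \<otimes> b \<oplus> a \<otimes> \<delta> b" if "a \<in> carrier R" "b \<in> carrier R" for a b
    using d that by (auto simp: derivation_def)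
  have "\<delta> \<zero> \<oplus> \<delta> \<zero> = \<delta> \<zero>" using d_add[of \<zero> \<zero>] by simp
  then have d_zero: "\<delta> \<zero> = \<zero>" by (simp add: dc)
  define J where "J = {a \<in> I. \<delta> a \<in> I}"
  have rJ: "right_ideal R J"
    using rI by (intro right_idealI)
      (auto simp: J_def d_zero d_add d_mult dc right_idealD right_ideal_memD[OF rI])
  have "J \<in> F"
  proof (rule gabriel_transitive[OF I rJ])
    fix a assume a: "a \<in> I"
    have ac: "a \<in> carrier R" using rI a by (rule right_ideal_memD)
    \<comment> \<open>This is \<open>(I : \<delta> a) \<subseteq> (J : a)\<close>: in
      \<open>\<delta> (a r) = (\<delta> a) r + a (\<delta> r)\<close> the last term is in
      \<open>I\<close> because \<open>a\<close> is.\<close>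
    have "a \<otimes> r \<in> J" if r: "r \<in> carrier R" "\<delta> a \<otimes> r \<in> I" for r
      using rI a r ac by (auto simp: J_def d_mult dc right_idealD)
    moreover have "right_ideal R (colon R J a)" using rJ ac by (rule right_ideal_colon)
    ultimately show "colon R J a \<in> F"
      by (intro gabriel_superset[OF gabriel_colon[OF I dc[OF ac]]]) (auto simp: colon_def)
  qed
  then show "\<exists>J\<in>F. \<delta> ` J \<subseteq> I" by (intro bexI[of _ J]) (auto simp: J_def)
qed

end

section \<open>Intersection of filters and restriction of scalars\<close>

lemma gabriel_filter_Int:
  assumes "gabriel_filter R F" "gabriel_filter R G"
  shows "gabriel_filter R (F \<inter> G)"
proof -
  interpret F: gabriel_filter R F by fact
  interpret G: gabriel_filter R G by fact
  show ?thesis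
    by unfold_locales
      (auto simp: F.gabriel_carrier G.gabriel_carrier
        intro: F.gabriel_right_ideal F.gabriel_colon F.gabriel_transitive
          G.gabriel_colon G.gabriel_transitive)
qed

text \<open>
  The \<open>T\<close>-modules that are torsion as \<open>R\<close>-modules via \<open>\<phi>\<close> are the torsion modules of this filter:
  the set in the definition is the annihilator in \<open>R\<close> of the coset \<open>K + x\<close>.
\<close>

definition pullback_filter ::
  "('a, 'm) ring_scheme \<Rightarrow> ('a \<Rightarrow> 'b) \<Rightarrow> ('b, 'n) ring_scheme \<Rightarrow> 'a set set \<Rightarrow> 'b set set"
  where "pullback_filter R \<phi> T F =
    {K. right_ideal T K \<and> (\<forall>x\<in>carrier T. {r \<in> carrier R. x \<otimes>\<^bsub>T\<^esub> \<phi> r \<in> K} \<in> F)}"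

lemma right_ideal_preimage:
  assumes "ring R" "ring T" and \<phi>: "\<phi> \<in> ring_hom R T" and K: "right_ideal T K" "x \<in> carrier T"
  shows "right_ideal R {r \<in> carrier R. x \<otimes>\<^bsub>T\<^esub> \<phi> r \<in> K}"
proof -
  interpret R: ring R by fact
  interpret T: ring T by fact
  have "\<phi> \<zero>\<^bsub>R\<^esub> = \<zero>\<^bsub>T\<^esub>" using ring_hom_zero[OF \<phi>] assms(1,2) by simp
  then show ?thesis
    using K by (intro R.right_idealI)
      (auto simp: ring_hom_closed[OF \<phi>] ring_hom_add[OF \<phi>] ring_hom_mult[OF \<phi>] T.r_distr
        T.m_assoc[symmetric] T.right_idealD)
qed

text \<open>By upward closure it is enough that each annihilator contains a member of
  \<open>F\<close>; an induction over tensors produces such members.\<close>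

lemma pullback_filterI:
  assumes "gabriel_filter R F" "ring T" "\<phi> \<in> ring_hom R T" "right_ideal T K"
    and ex: "\<And>x. x \<in> carrier T \<Longrightarrow> \<exists>J\<in>F. \<forall>r\<in>J. x \<otimes>\<^bsub>T\<^esub> \<phi> r \<in> K"
  shows "K \<in> pullback_filter R \<phi> T F"
proof -
  interpret F: gabriel_filter R F by fact
  have "{r \<in> carrier R. x \<otimes>\<^bsub>T\<^esub> \<phi> r \<in> K} \<in> F" if x: "x \<in> carrier T" for x
  proof -
    obtain J where J: "J \<in> F" "\<forall>r\<in>J. x \<otimes>\<^bsub>T\<^esub> \<phi> r \<in> K" using ex[OF x] by blast
    have "J \<subseteq> carrier R" using F.gabriel_right_ideal[OF J(1)] by (rule F.right_idealD)
    with J show ?thesis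
      using right_ideal_preimage[OF F.ring_axioms assms(2-4) x] by (auto intro: F.gabriel_superset[OF J(1)])
  qed
  with assms(4) show ?thesis by (simp add: pullback_filter_def)
qed

lemma gabriel_filter_pullback:
  assumes "gabriel_filter R F" "ring T" and \<phi>: "\<phi> \<in> ring_hom R T"
  shows "gabriel_filter T (pullback_filter R \<phi> T F)"
proof -
  interpret F: gabriel_filter R F by fact
  interpret T: ring T by fact
  note closed [simp] = ring_hom_closed[OF \<phi>]
  define P where "P K x = {r \<in> carrier R. x \<otimes>\<^bsub>T\<^esub> \<phi> r \<in> K}" for K x
  have mem: "K \<in> pullback_filter R \<phi> T F \<longleftrightarrow> right_ideal T K \<and> (\<forall>x\<in>carrier T. P K x \<in> F)" for K
    by (simp add: pullback_filter_def P_def)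
  \<comment> \<open>Passing from \<open>K\<close> to \<open>(K : a)\<close> only moves the point
    \<open>x\<close> to \<open>a x\<close>, so the condition for \<open>(K : a)\<close> is part of
    the one for \<open>K\<close>.\<close>
  have P_colon: "P (colon T K a) x = P K (a \<otimes>\<^bsub>T\<^esub> x)" if "a \<in> carrier T" "x \<in> carrier T" for K a x
    using that by (auto simp: P_def colon_def T.m_assoc)
  have P_ideal: "right_ideal R (P K x)" if "right_ideal T K" "x \<in> carrier T" for K x
    using right_ideal_preimage[OF F.ring_axioms assms(2) \<phi> that] by (simp add: P_def)
  show ?thesis
  proof unfold_locales
    have "P (carrier T) x = carrier R" if "x \<in> carrier T" for x using that by (auto simp: P_def)
    then show "carrier T \<in> pullback_filter R \<phi> T F"
      by (simp add: mem T.right_ideal_carrier F.gabriel_carrier)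
  next
    fix I a assume "I \<in> pullback_filter R \<phi> T F" "a \<in> carrier T"
    then show "colon T I a \<in> pullback_filter R \<phi> T F"
      by (auto simp: mem P_colon T.right_ideal_colon)
  next
    fix I J assume I: "I \<in> pullback_filter R \<phi> T F" and J: "right_ideal T J"
      and IJ: "\<And>a. a \<in> I \<Longrightarrow> colon T J a \<in> pullback_filter R \<phi> T F"
    have "P J x \<in> F" if x: "x \<in> carrier T" for x
    proof (rule F.gabriel_transitive)
      show "P I x \<in> F" using I x by (simp add: mem)
      show "right_ideal R (P J x)" using J x by (rule P_ideal)
      fix q assume "q \<in> P I x"
      then have q: "q \<in> carrier R" "x \<otimes>\<^bsub>T\<^esub> \<phi> q \<in> I" by (auto simp: P_def)
      \<comment> \<open>The colon ideal at \<open>x \<phi>(q)\<close> is evaluated at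
        \<open>\<one>\<close> only, where its condition says that \<open>(P J x : q)\<close> lies in
        \<open>F\<close>.\<close>
      have "P (colon T J (x \<otimes>\<^bsub>T\<^esub> \<phi> q)) \<one>\<^bsub>T\<^esub> \<in> F" using IJ[OF q(2)] by (simp add: mem)
      moreover have "P (colon T J (x \<otimes>\<^bsub>T\<^esub> \<phi> q)) \<one>\<^bsub>T\<^esub> = colon R (P J x) q"
        using x q(1) by (auto simp: P_def colon_def T.m_assoc ring_hom_mult[OF \<phi>])
      ultimately show "colon R (P J x) q \<in> F" by simp
    qed
    with J show "J \<in> pullback_filter R \<phi> T F" by (simp add: mem)
  qed (simp add: mem)
qed


section \<open>The symmetric filter\<close>

context two_rings
begin

interpretation T: ring "tensor_ring R S" by (rule ring_tensor_ring)

lemma pure_tensor_closed: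
  "\<lbrakk>a \<in> carrier R; b \<in> carrier S\<rbrakk> \<Longrightarrow> pure_tensor R S a b \<in> carrier (tensor_ring R S)"
  by (simp add: pure_tensor_def cl_carrier keys_frag_of)

lemma pure_tensor_mult:
  "\<lbrakk>a \<in> carrier R; b \<in> carrier S; c \<in> carrier R; d \<in> carrier S\<rbrakk> \<Longrightarrow>
    pure_tensor R S a b \<otimes>\<^bsub>tensor_ring R S\<^esub> pure_tensor R S c d =
    pure_tensor R S (a \<otimes>\<^bsub>R\<^esub> c) (b \<otimes>\<^bsub>S\<^esub> d)"
  by (simp add: pure_tensor_def cl_mult keys_frag_of pair_mult_of)

lemma pure_tensor_one: "pure_tensor R S \<one>\<^bsub>R\<^esub> \<one>\<^bsub>S\<^esub> = \<one>\<^bsub>tensor_ring R S\<^esub>"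
  by (simp add: pure_tensor_def tensor_ring_def FactRing_def pair_ring_simps)

lemma pure_tensor_add:
  assumes "a \<in> carrier R" "b \<in> carrier S"
  shows "a' \<in> carrier R \<Longrightarrow> pure_tensor R S (a \<oplus>\<^bsub>R\<^esub> a') b =
      pure_tensor R S a b \<oplus>\<^bsub>tensor_ring R S\<^esub> pure_tensor R S a' b"
    "b' \<in> carrier S \<Longrightarrow> pure_tensor R S a (b \<oplus>\<^bsub>S\<^esub> b') =
      pure_tensor R S a b \<oplus>\<^bsub>tensor_ring R S\<^esub> pure_tensor R S a b'"
  using assms bilinear_left[of a a' b] bilinear_right[of a b b']
  by (auto simp: pure_tensor_def cl_add keys_frag_of diff_diff_eq intro!: cl_eq)

lemma pure_tensor_ring_hom:
  "(\<lambda>r. pure_tensor R S r \<one>\<^bsub>S\<^esub>) \<in> ring_hom R (tensor_ring R S)"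
  "(\<lambda>s. pure_tensor R S \<one>\<^bsub>R\<^esub> s) \<in> ring_hom S (tensor_ring R S)"
  by (rule ring_hom_memI;
      simp add: pure_tensor_closed pure_tensor_mult pure_tensor_add pure_tensor_one)+

text \<open>Pure tensors generate additively. The inductive step is a difference, as in
  \<open>frag_induction\<close> on representatives; this covers sums and negatives at once.\<close>

lemma tensor_induct [consumes 1, case_names zero pure diff]:
  assumes "X \<in> carrier (tensor_ring R S)" "P \<zero>\<^bsub>tensor_ring R S\<^esub>"
    and pure: "\<And>a b. \<lbrakk>a \<in> carrier R; b \<in> carrier S\<rbrakk> \<Longrightarrow> P (pure_tensor R S a b)"
    and diff: "\<And>x y. \<lbrakk>x \<in> carrier (tensor_ring R S); y \<in> carrier (tensor_ring R S); P x; P y\<rbrakk> \<Longrightarrow>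
      P (x \<ominus>\<^bsub>tensor_ring R S\<^esub> y)"
  shows "P X"
proof -
  obtain x where x: "Poly_Mapping.keys x \<subseteq> C" "X = cl x" using assms(1) by (rule carrier_tensor)
  have cl0: "cl 0 = \<zero>\<^bsub>tensor_ring R S\<^esub>"
  proof -
    have "cl 0 \<oplus>\<^bsub>tensor_ring R S\<^esub> cl 0 = cl 0" by (simp add: cl_add)
    moreover have "cl 0 \<in> carrier (tensor_ring R S)" by (simp add: cl_carrier)
    ultimately show ?thesis by simp
  qed
  \<comment> \<open>The support bound is carried along since the difference case needs it for
    \<open>cl_add\<close> and \<open>cl_carrier\<close>.\<close>
  have "Poly_Mapping.keys x \<subseteq> C \<and> P (cl x)"
    using x(1)
  proof (induction x rule: frag_induction)
    case (one p)
    then show ?case using pure by (auto simp: pure_tensor_def keys_frag_of)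
  next
    case (diff y z)
    have keys: "Poly_Mapping.keys (y - z) \<subseteq> C" using diff by (simp add: keys_diff_subset)
    have "cl (y - z) \<oplus>\<^bsub>tensor_ring R S\<^esub> cl z = cl y"
      using diff keys cl_add[of "y - z" z] by simp
    then have "cl (y - z) = cl y \<ominus>\<^bsub>tensor_ring R S\<^esub> cl z"
      using diff keys cl_carrier
      by (metis T.minus_eq T.add.inv_solve_right)
    then show ?case using diff keys assms(4)[of "cl y" "cl z"] by (simp add: cl_carrier)
  qed (use assms(2) cl0 in auto)
  with x(2) show ?thesis by simp
qed

lemma tensor_image_subset:
  assumes K: "right_ideal (tensor_ring R S) K"
    and *: "\<And>a b. \<lbrakk>a \<in> U; b \<in> V\<rbrakk> \<Longrightarrow> pure_tensor R S a b \<in> K"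
  shows "tensor_image R S U V \<subseteq> K"
proof -
  have "subgroup K (add_monoid (tensor_ring R S))"
    using K by (simp add: right_ideal_def additive_subgroup_def)
  then show ?thesis
    unfolding tensor_image_def
    by (rule T.add.generate_subgroup_incl[rotated]) (use * in auto)
qed

lemma gabriel_filter_tensor_sum:
  assumes "gabriel_filter R F" "gabriel_filter S G"
  shows "gabriel_filter (tensor_ring R S)
    {K. right_ideal (tensor_ring R S) K \<and>
      (\<exists>I\<in>G. \<exists>J\<in>F. tensor_image R S J (carrier S) <+>\<^bsub>tensor_ring R S\<^esub>
        tensor_image R S (carrier R) I \<subseteq> K)}" (is "gabriel_filter ?T ?H")
proof -
  interpret F: gabriel_filter R F by fact
  interpret G: gabriel_filter S G by fact
  let ?\<phi> = "\<lambda>r. pure_tensor R S r \<one>\<^bsub>S\<^esub>" and ?\<psi> = "\<lambda>s. pure_tensor R S \<one>\<^bsub>R\<^esub> s"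
  note T_closed [simp] = pure_tensor_closed
  \<comment> \<open>From left to right, members of \<open>F\<close> and \<open>G\<close> are found
    by induction on \<open>x\<close>; from right to left, the conditions at
    \<open>x = \<one>\<close> already supply \<open>J\<close> and \<open>I\<close>.\<close>
  have "?H = pullback_filter R ?\<phi> ?T F \<inter> pullback_filter S ?\<psi> ?T G" (is "_ = ?L \<inter> ?M")
  proof (intro equalityI subsetI)
    fix K assume "K \<in> ?H"
    then obtain I J where K: "right_ideal ?T K" and I: "I \<in> G" and J: "J \<in> F"
      and sub: "tensor_image R S J (carrier S) <+>\<^bsub>?T\<^esub> tensor_image R S (carrier R) I \<subseteq> K"
      by blast
    have pure_mem: "pure_tensor R S a b \<in> tensor_image R S U V" if "a \<in> U" "b \<in> V" for a b U V
      using that unfolding tensor_image_def by (intro generate.incl) blast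
    \<comment> \<open>Zero in either summand lets the condition on the sum place each tensor image
      in \<open>K\<close> separately.\<close>
    have zero_mem: "\<zero>\<^bsub>?T\<^esub> \<in> tensor_image R S U V" for U V
      unfolding tensor_image_def using generate.one[of "add_monoid ?T"] by simp
    have sum_mem: "x \<oplus>\<^bsub>?T\<^esub> y \<in> K"
      if "x \<in> tensor_image R S J (carrier S)" "y \<in> tensor_image R S (carrier R) I" for x y
      using that sub by (auto simp: set_add_def')
    have JK: "pure_tensor R S j s \<in> K" if "j \<in> J" "s \<in> carrier S" for j s
    proof -
      have "j \<in> carrier R" using F.gabriel_right_ideal[OF J] that(1) by (rule R.right_ideal_memD)
      then show ?thesis using sum_mem[OF pure_mem[OF that] zero_mem] that by simp
    qed
    have IK: "pure_tensor R S r i \<in> K" if "r \<in> carrier R" "i \<in> I" for r i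
    proof -
      have "i \<in> carrier S" using G.gabriel_right_ideal[OF I] that(2) by (rule S.right_ideal_memD)
      then show ?thesis using sum_mem[OF zero_mem pure_mem[OF that]] that by simp
    qed
    \<comment> \<open>The difference step of both inductions: what sends \<open>x\<close> and
      \<open>y\<close> into \<open>K\<close> sends \<open>x \<ominus> y\<close> there.\<close>
    have diffK: "(x \<ominus>\<^bsub>?T\<^esub> y) \<otimes>\<^bsub>?T\<^esub> z \<in> K"
      if "x \<in> carrier ?T" "y \<in> carrier ?T" "z \<in> carrier ?T" "x \<otimes>\<^bsub>?T\<^esub> z \<in> K" "y \<otimes>\<^bsub>?T\<^esub> z \<in> K" for x y z
      using that K by (simp add: T.minus_eq T.l_distr T.l_minus T.right_idealD)
    have "\<exists>J\<in>F. \<forall>r\<in>J. x \<otimes>\<^bsub>?T\<^esub> ?\<phi> r \<in> K" if "x \<in> carrier ?T" for x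
      using that
    proof (induction x rule: tensor_induct)
      case zero
      then show ?case using F.gabriel_carrier K
        by (intro bexI[of _ "carrier R"]) (auto simp: T.right_idealD)
    next
      case (pure a b)
      \<comment> \<open>\<open>(a \<otimes> b) (r \<otimes> 1) = a r \<otimes> b\<close>, with
        \<open>a r\<close> in \<open>J\<close> for \<open>r\<close> in
        \<open>(J : a)\<close>.\<close>
      then show ?case using F.gabriel_colon[OF J, of a] JK
        by (intro bexI[of _ "colon R J a"]) (auto simp: pure_tensor_mult colon_def)
    next
      case (diff x y)
      then obtain J1 J2 where "J1 \<in> F" "J2 \<in> F"
        "\<forall>r\<in>J1. x \<otimes>\<^bsub>?T\<^esub> ?\<phi> r \<in> K" "\<forall>r\<in>J2. y \<otimes>\<^bsub>?T\<^esub> ?\<phi> r \<in> K" by blast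
      then show ?case using diff(1,2) F.gabriel_Int[of J1 J2] F.gabriel_right_ideal[of J1]
        by (intro bexI[of _ "J1 \<inter> J2"]) (auto intro!: diffK dest: R.right_ideal_memD)
    qed
    moreover have "\<exists>I\<in>G. \<forall>s\<in>I. x \<otimes>\<^bsub>?T\<^esub> ?\<psi> s \<in> K" if "x \<in> carrier ?T" for x
      using that
    proof (induction x rule: tensor_induct)
      case zero
      then show ?case using G.gabriel_carrier K
        by (intro bexI[of _ "carrier S"]) (auto simp: T.right_idealD)
    next
      case (pure a b)
      \<comment> \<open>Symmetrically,
        \<open>(a \<otimes> b) (1 \<otimes> s) = a \<otimes> b s\<close>, with \<open>b s\<close> in
        \<open>I\<close> for \<open>s\<close> in \<open>(I : b)\<close>.\<close>
      then show ?case using G.gabriel_colon[OF I, of b] IK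
        by (intro bexI[of _ "colon S I b"]) (auto simp: pure_tensor_mult colon_def)
    next
      case (diff x y)
      then obtain I1 I2 where "I1 \<in> G" "I2 \<in> G"
        "\<forall>s\<in>I1. x \<otimes>\<^bsub>?T\<^esub> ?\<psi> s \<in> K" "\<forall>s\<in>I2. y \<otimes>\<^bsub>?T\<^esub> ?\<psi> s \<in> K" by blast
      then show ?case using diff(1,2) G.gabriel_Int[of I1 I2] G.gabriel_right_ideal[of I1]
        by (intro bexI[of _ "I1 \<inter> I2"]) (auto intro!: diffK dest: S.right_ideal_memD)
    qed
    ultimately show "K \<in> ?L \<inter> ?M"
      using K assms pure_tensor_ring_hom T.ring_axioms by (auto intro!: pullback_filterI)
  next
    fix K assume KLM: "K \<in> ?L \<inter> ?M"
    then have K: "right_ideal ?T K" by (simp add: pullback_filter_def)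
    define J where "J = {r \<in> carrier R. ?\<phi> r \<in> K}"
    define I where "I = {s \<in> carrier S. ?\<psi> s \<in> K}"
    have "{r \<in> carrier R. \<one>\<^bsub>?T\<^esub> \<otimes>\<^bsub>?T\<^esub> ?\<phi> r \<in> K} \<in> F" "{s \<in> carrier S. \<one>\<^bsub>?T\<^esub> \<otimes>\<^bsub>?T\<^esub> ?\<psi> s \<in> K} \<in> G"
      using KLM T.one_closed unfolding pullback_filter_def by blast+
    then have "J \<in> F" "I \<in> G"
      by (simp_all add: J_def I_def cong: conj_cong)
    moreover have "tensor_image R S J (carrier S) \<subseteq> K"
    proof (rule tensor_image_subset[OF K])
      fix a b assume "a \<in> J" "b \<in> carrier S"
      \<comment> \<open>\<open>a \<otimes> b = (a \<otimes> 1) (1 \<otimes> b)\<close>, and the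
        first factor lies in \<open>K\<close>.\<close>
      then show "pure_tensor R S a b \<in> K"
        using T.right_idealD(5)[OF K, of "?\<phi> a" "?\<psi> b"] by (simp add: J_def pure_tensor_mult)
    qed
    moreover have "tensor_image R S (carrier R) I \<subseteq> K"
    proof (rule tensor_image_subset[OF K])
      fix a b assume "a \<in> carrier R" "b \<in> I"
      \<comment> \<open>The factors \<open>a \<otimes> 1\<close> and \<open>1 \<otimes> b\<close>
        commute, so the one lying in \<open>K\<close>, now \<open>1 \<otimes> b\<close>, can be put
        first.\<close>
      then show "pure_tensor R S a b \<in> K"
        using T.right_idealD(5)[OF K, of "?\<psi> b" "?\<phi> a"] by (simp add: I_def pure_tensor_mult)
    qed
    ultimately show "K \<in> ?H"
      using K by (auto simp: set_add_def' intro!: bexI[of _ I] bexI[of _ J] T.right_idealD(3))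
  qed
  then show ?thesis
    using assms pure_tensor_ring_hom T.ring_axioms
    by (simp add: gabriel_filter_Int gabriel_filter_pullback)
qed

end

lemma differential_filter_symmetric:
  assumes "ring R" "gabriel_filter (op_ring R) Fl" "gabriel_filter R Fr"
  shows "differential_filter (enveloping_ring R) (symmetric_filter R Fl Fr)"
proof -
  interpret two_rings R "op_ring R" by (simp add: two_rings_def assms(1) ring_op_ring)
  show ?thesis
    unfolding symmetric_filter_def
    \<comment> \<open>Right ideals of \<open>R\<close> belong to the first tensor factor, left
      ideals (right ideals of \<open>op_ring R\<close>) to the second; hence the swapped order of
      the assumptions.\<close>
    by (rule gabriel_filter.differential_filter_gabriel[OF gabriel_filter_tensor_sum[OF assms(3,2)]])
qed


section \<open>The Lambek and Goldie filters\<close>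

lemma gabriel_filter_lambek:
  assumes "ring R"
  shows "gabriel_filter R (right_lambek_filter R)"
proof -
  interpret ring R by fact
  have mem: "I \<in> right_lambek_filter R \<longleftrightarrow> right_ideal R I \<and> (\<forall>a\<in>carrier R. \<forall>b\<in>carrier R.
      a \<noteq> \<zero>\<^bsub>R\<^esub> \<longrightarrow> (\<exists>r\<in>carrier R. a \<otimes>\<^bsub>R\<^esub> r \<noteq> \<zero>\<^bsub>R\<^esub> \<and> b \<otimes>\<^bsub>R\<^esub> r \<in> I))" for I
    by (simp add: right_lambek_filter_def dense_right_ideal_def)
  have dense: "\<exists>r\<in>carrier R. a \<otimes>\<^bsub>R\<^esub> r \<noteq> \<zero>\<^bsub>R\<^esub> \<and> b \<otimes>\<^bsub>R\<^esub> r \<in> I"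
    if "I \<in> right_lambek_filter R" "a \<in> carrier R" "b \<in> carrier R" "a \<noteq> \<zero>\<^bsub>R\<^esub>" for I a b
    using that by (simp add: mem)
  show ?thesis
  proof unfold_locales
    show "carrier R \<in> right_lambek_filter R"
      by (auto simp: mem right_ideal_carrier intro!: bexI[of _ "\<one>\<^bsub>R\<^esub>"])
  next
    fix I c assume I: "I \<in> right_lambek_filter R" and c: "c \<in> carrier R"
    have "\<exists>r\<in>carrier R. a \<otimes>\<^bsub>R\<^esub> r \<noteq> \<zero>\<^bsub>R\<^esub> \<and> b \<otimes>\<^bsub>R\<^esub> r \<in> colon R I c"
      if ab: "a \<in> carrier R" "b \<in> carrier R" "a \<noteq> \<zero>\<^bsub>R\<^esub>" for a b
    proof -
      \<comment> \<open>Density of \<open>I\<close> is used at the pair \<open>a\<close>,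
        \<open>c b\<close>.\<close>
      obtain r where "r \<in> carrier R" "a \<otimes>\<^bsub>R\<^esub> r \<noteq> \<zero>\<^bsub>R\<^esub>" "(c \<otimes>\<^bsub>R\<^esub> b) \<otimes>\<^bsub>R\<^esub> r \<in> I"
        using dense[OF I ab(1) m_closed[OF c ab(2)] ab(3)] by blast
      then show ?thesis using ab c by (auto simp: colon_def m_assoc)
    qed
    then show "colon R I c \<in> right_lambek_filter R"
      using I c by (simp add: mem right_ideal_colon)
  next
    fix I J assume I: "I \<in> right_lambek_filter R" and J: "right_ideal R J"
      and IJ: "\<And>a. a \<in> I \<Longrightarrow> colon R J a \<in> right_lambek_filter R"
    have "\<exists>r\<in>carrier R. a \<otimes>\<^bsub>R\<^esub> r \<noteq> \<zero>\<^bsub>R\<^esub> \<and> b \<otimes>\<^bsub>R\<^esub> r \<in> J"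
      if ab: "a \<in> carrier R" "b \<in> carrier R" "a \<noteq> \<zero>\<^bsub>R\<^esub>" for a b
    proof -
      \<comment> \<open>First \<open>b\<close> is moved into \<open>I\<close>; then density of
        \<open>(J : b r)\<close> at the pair \<open>a r\<close>, \<open>\<one>\<close> gives
        \<open>s\<close>, and \<open>r s\<close> is the witness.\<close>
      obtain r where r: "r \<in> carrier R" "a \<otimes>\<^bsub>R\<^esub> r \<noteq> \<zero>\<^bsub>R\<^esub>" "b \<otimes>\<^bsub>R\<^esub> r \<in> I"
        using dense[OF I ab] by blast
      then obtain s where "s \<in> carrier R" "(a \<otimes>\<^bsub>R\<^esub> r) \<otimes>\<^bsub>R\<^esub> s \<noteq> \<zero>\<^bsub>R\<^esub>"
          "\<one>\<^bsub>R\<^esub> \<otimes>\<^bsub>R\<^esub> s \<in> colon R J (b \<otimes>\<^bsub>R\<^esub> r)"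
        using dense[OF IJ[OF r(3)] m_closed[OF ab(1) r(1)] one_closed r(2)] by blast
      then show ?thesis
        using ab r by (intro bexI[of _ "r \<otimes>\<^bsub>R\<^esub> s"]) (auto simp: colon_def m_assoc)
    qed
    with J show "J \<in> right_lambek_filter R" by (simp add: mem)
  qed (simp add: mem)
qed

text \<open>The right ideal \<open>Z(I)\<close> for which \<open>Z(I)/I\<close> is the singular submodule of \<open>R/I\<close>:\<close>

definition singular_closure :: "('a, 'm) ring_scheme \<Rightarrow> 'a set \<Rightarrow> 'a set"
  where "singular_closure R I = {x \<in> carrier R. essential_right_ideal R (colon R I x)}"

section \<open>Essential right ideals and singular closure\<close>

context ring
begin

text \<open>Essentiality can be tested on principal right ideals \<open>a R\<close>, since every
  nonzero right ideal contains a nonzero one.\<close>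

lemma essential_right_ideal_iff:
  "essential_right_ideal R E \<longleftrightarrow> right_ideal R E \<and>
    (\<forall>a\<in>carrier R. a \<noteq> \<zero> \<longrightarrow> (\<exists>r\<in>carrier R. a \<otimes> r \<noteq> \<zero> \<and> a \<otimes> r \<in> E))"
    (is "?L \<longleftrightarrow> ?R")
proof
  assume L: ?L
  have "\<exists>r\<in>carrier R. a \<otimes> r \<noteq> \<zero> \<and> a \<otimes> r \<in> E" if a: "a \<in> carrier R" "a \<noteq> \<zero>" for a
  proof -
    have "right_ideal R ((\<otimes>) a ` carrier R)"
      using a by (intro right_idealI)
        (auto simp: r_distr[symmetric] m_assoc intro: rev_image_eqI[of \<zero>])
    moreover have "a \<in> (\<otimes>) a ` carrier R" using a by (intro rev_image_eqI[of \<one>]) auto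
    ultimately have "E \<inter> (\<otimes>) a ` carrier R \<noteq> {\<zero>}" "\<zero> \<in> E \<inter> (\<otimes>) a ` carrier R"
      using L a by (auto simp: essential_right_ideal_def right_idealD)
    then show ?thesis by blast
  qed
  with L show ?R by (simp add: essential_right_ideal_def)
next
  assume R: ?R
  have "E \<inter> K \<noteq> {\<zero>}" if K: "right_ideal R K" "K \<noteq> {\<zero>}" for K
  proof -
    obtain a where a: "a \<in> K" "a \<noteq> \<zero>" using K right_idealD(2)[OF K(1)] by blast
    then obtain r where "r \<in> carrier R" "a \<otimes> r \<noteq> \<zero>" "a \<otimes> r \<in> E"
      using R right_ideal_memD[OF K(1)] by blast
    then show ?thesis using right_idealD(5)[OF K(1) a(1)] by blast
  qed
  with R show ?L by (simp add: essential_right_ideal_def)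
qed

lemma essential_carrier: "essential_right_ideal R (carrier R)"
  by (auto simp: essential_right_ideal_iff right_ideal_carrier intro!: bexI[of _ \<one>])

lemma essential_superset:
  "\<lbrakk>essential_right_ideal R E; right_ideal R E'; E \<subseteq> E'\<rbrakk> \<Longrightarrow> essential_right_ideal R E'"
  unfolding essential_right_ideal_iff by blast

text \<open>A nonzero multiple of \<open>a\<close> in \<open>E\<close> is multiplied once more into
  \<open>E'\<close>; being a right ideal, \<open>E\<close> retains it.\<close>

lemma essential_Int:
  assumes "essential_right_ideal R E" "essential_right_ideal R E'"
  shows "essential_right_ideal R (E \<inter> E')"
proof -
  have r: "right_ideal R E" "right_ideal R E'" using assms by (auto simp: essential_right_ideal_def)
  have "\<exists>r\<in>carrier R. a \<otimes> r \<noteq> \<zero> \<and> a \<otimes> r \<in> E \<inter> E'" if a: "a \<in> carrier R" "a \<noteq> \<zero>" for a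
  proof -
    obtain r where r1: "r \<in> carrier R" "a \<otimes> r \<noteq> \<zero>" "a \<otimes> r \<in> E"
      using assms(1) a unfolding essential_right_ideal_iff by blast
    obtain s where "s \<in> carrier R" "(a \<otimes> r) \<otimes> s \<noteq> \<zero>" "(a \<otimes> r) \<otimes> s \<in> E'"
      using assms(2) r1 m_closed[OF a(1) r1(1)] unfolding essential_right_ideal_iff by blast
    then show ?thesis
      using r1 a right_idealD(5)[OF r(1) r1(3)]
      by (intro bexI[of _ "r \<otimes> s"]) (auto simp: m_assoc)
  qed
  moreover have "right_ideal R (E \<inter> E')"
    using r by (intro right_idealI) (auto simp: right_idealD dest: right_ideal_memD)
  ultimately show ?thesis by (simp add: essential_right_ideal_iff)
qed

lemma essential_colon:
  assumes E: "essential_right_ideal R E" and c: "c \<in> carrier R"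
  shows "essential_right_ideal R (colon R E c)"
proof -
  have r: "right_ideal R E" using E by (simp add: essential_right_ideal_def)
  have "\<exists>r\<in>carrier R. a \<otimes> r \<noteq> \<zero> \<and> a \<otimes> r \<in> colon R E c" if a: "a \<in> carrier R" "a \<noteq> \<zero>" for a
  \<comment> \<open>If \<open>c a = 0\<close>, then \<open>a\<close> itself is in the colon ideal.
    Otherwise a nonzero multiple \<open>c a r\<close> in \<open>E\<close> forces
    \<open>a r \<noteq> 0\<close>.\<close>
  proof (cases "c \<otimes> a = \<zero>")
    case True
    then show ?thesis using a r by (intro bexI[of _ \<one>]) (auto simp: colon_def right_idealD)
  next
    case False
    then obtain r where "r \<in> carrier R" "(c \<otimes> a) \<otimes> r \<noteq> \<zero>" "(c \<otimes> a) \<otimes> r \<in> E"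
      using E m_closed[OF c a(1)] unfolding essential_right_ideal_iff by blast
    then show ?thesis using a c by (intro bexI[of _ r]) (auto simp: colon_def m_assoc)
  qed
  then show ?thesis using right_ideal_colon[OF r c] by (simp add: essential_right_ideal_iff)
qed

text \<open>For sums, \<open>(I : a) \<inter> (I : b) \<subseteq> (I : a + b)\<close>; for
  multiples, \<open>(I : a r) = ((I : a) : r)\<close>, which is essential by
  \<open>essential_colon\<close>.\<close>

lemma right_ideal_singular_closure:
  assumes I: "right_ideal R I"
  shows "right_ideal R (singular_closure R I)"
proof (rule right_idealI)
  show "\<zero> \<in> singular_closure R I"
    using I by (simp add: singular_closure_def colon_mem_eq_carrier right_idealD essential_carrier)
next
  fix a b assume a: "a \<in> singular_closure R I" and b: "b \<in> singular_closure R I"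
  then have c: "a \<in> carrier R" "b \<in> carrier R" by (auto simp: singular_closure_def)
  have "colon R I a \<inter> colon R I b \<subseteq> colon R I (a \<oplus> b)"
    using I c by (auto simp: colon_def l_distr right_idealD)
  moreover have "essential_right_ideal R (colon R I a \<inter> colon R I b)"
    using a b by (simp add: singular_closure_def essential_Int)
  ultimately have "essential_right_ideal R (colon R I (a \<oplus> b))"
    using essential_superset right_ideal_colon[OF I] c by blast
  then show "a \<oplus> b \<in> singular_closure R I" using c by (simp add: singular_closure_def)
next
  fix a r assume "a \<in> singular_closure R I" "r \<in> carrier R"
  then show "a \<otimes> r \<in> singular_closure R I"
    using I essential_colon[of "colon R I a" r] by (simp add: singular_closure_def colon_colon)
qed (auto simp: singular_closure_def)

lemma singular_closure_superset: "right_ideal R I \<Longrightarrow> I \<subseteq> singular_closure R I"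
  by (auto simp: singular_closure_def colon_mem_eq_carrier essential_carrier dest: right_ideal_memD)

lemma singular_closure_mono:
  assumes "right_ideal R I" "right_ideal R J" "I \<subseteq> J"
  shows "singular_closure R I \<subseteq> singular_closure R J"
proof
  fix x assume "x \<in> singular_closure R I"
  then have x: "x \<in> carrier R" "essential_right_ideal R (colon R I x)"
    by (auto simp: singular_closure_def)
  have "colon R I x \<subseteq> colon R J x" using assms(3) by (auto simp: colon_def)
  then show "x \<in> singular_closure R J"
    using essential_superset[OF x(2) right_ideal_colon[OF assms(2) x(1)]] x(1)
    by (simp add: singular_closure_def)
qed

text \<open>Membership of \<open>x\<close> in either side means that \<open>(I : a x)\<close> is
  essential.\<close>

lemma singular_closure_colon:
  "\<lbrakk>right_ideal R I; a \<in> carrier R\<rbrakk> \<Longrightarrow>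
    singular_closure R (colon R I a) = colon R (singular_closure R I) a"
  by (auto simp: singular_closure_def colon_colon colon_def[of R "{x \<in> carrier R. P x}" for P])

text \<open>
  An element \<open>r \<noteq> 0\<close> of \<open>E\<close> in a right ideal meeting the singular closure trivially would have an
  essential annihilator, hence lie in the singular closure.
\<close>

lemma essential_singular_closure:
  assumes I: "right_ideal R I" and E: "essential_right_ideal R E"
    and *: "\<And>r. r \<in> E \<Longrightarrow> essential_right_ideal R (colon R (singular_closure R I) r)"
  shows "essential_right_ideal R (singular_closure R I)"
  unfolding essential_right_ideal_def
proof (intro conjI allI impI right_ideal_singular_closure[OF I] notI; elim conjE)
  fix K assume K: "right_ideal R K" "K \<noteq> {\<zero>}" and 0: "singular_closure R I \<inter> K = {\<zero>}"
  have "E \<inter> K \<noteq> {\<zero>}" "\<zero> \<in> E \<inter> K"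
    using E K by (auto simp: essential_right_ideal_def right_idealD)
  then obtain r where r: "r \<in> E" "r \<in> K" "r \<noteq> \<zero>" by blast
  have rc: "r \<in> carrier R" using K(1) r(2) by (rule right_ideal_memD)
  have "colon R (singular_closure R I) r \<subseteq> colon R I r"
  proof
    fix x assume "x \<in> colon R (singular_closure R I) r"
    then have "x \<in> carrier R" "r \<otimes> x \<in> singular_closure R I \<inter> K"
      using right_idealD(5)[OF K(1) r(2)] by (auto simp: colon_def)
    then show "x \<in> colon R I r" using 0 right_idealD(2)[OF I] by (auto simp: colon_def)
  qed
  then have "essential_right_ideal R (colon R I r)"
    using essential_superset[OF *[OF r(1)]] right_ideal_colon[OF I rc] by blast
  then show False using 0 r rc by (auto simp: singular_closure_def)
qed

text \<open>One step may fall short: for \<open>I = 0\<close> in the integers modulo 4 the first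
  closure is the multiples of 2, the second the whole ring.\<close>

lemma singular_closure_idem2:
  assumes I: "right_ideal R I"
  shows "singular_closure R (singular_closure R (singular_closure R I)) =
    singular_closure R (singular_closure R I)" (is "?Z3 = ?Z2")
proof (rule subset_antisym)
  have Z: "right_ideal R (singular_closure R I)" using I by (rule right_ideal_singular_closure)
  show "?Z2 \<subseteq> ?Z3" by (rule singular_closure_superset[OF right_ideal_singular_closure[OF Z]])
  show "?Z3 \<subseteq> ?Z2"
  proof
    fix x assume "x \<in> ?Z3"
    then have x: "x \<in> carrier R" and E: "essential_right_ideal R (colon R ?Z2 x)"
      by (auto simp: singular_closure_def[of R ?Z2])
    \<comment> \<open>The closure of \<open>(I : x)\<close> is \<open>(Z(I) : x)\<close>, whose
      essentiality means \<open>x \<in> ?Z2\<close>; the essential ideal used to test it is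
      \<open>(?Z2 : x)\<close>.\<close>
    have "essential_right_ideal R (singular_closure R (colon R I x))"
    proof (rule essential_singular_closure[OF right_ideal_colon[OF I x] E])
      fix r assume "r \<in> colon R ?Z2 x"
      then have r: "r \<in> carrier R" "x \<otimes> r \<in> ?Z2" by (auto simp: colon_def[of R ?Z2])
      then show "essential_right_ideal R (colon R (singular_closure R (colon R I x)) r)"
        using x I Z
        by (simp add: singular_closure_colon colon_colon
            singular_closure_def[of R "singular_closure R I"])
    qed
    then show "x \<in> ?Z2"
      using x I by (simp add: singular_closure_colon singular_closure_def[of R "singular_closure R I"])
  qed
qed

section \<open>Goldie torsion in terms of singular closure\<close>

lemma nonsingular_quotient_module:
  assumes W: "right_ideal R W" and closed: "singular_closure R W = W"
  shows "quotient_module R W \<in> nonsingular_modules R"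
proof -
  let ?Q = "quotient_module R W"
  \<comment> \<open>Hence the singular submodule of \<open>R/W\<close> is \<open>Z(W)/W\<close>,
    which vanishes for closed \<open>W\<close>.\<close>
  have ann: "annihilator R ?Q (W +> x) = colon R W x" if x: "x \<in> carrier R" for x
    unfolding annihilator_def colon_def
    by (intro Collect_cong conj_cong refl)
      (simp only: quotient_module_smult[OF W x] quotient_module_zero[OF W]
        coset_eq_iff[OF W m_closed[OF x]])
  have mem: "W +> x \<in> singular_submodule R ?Q \<longleftrightarrow> x \<in> W" if x: "x \<in> carrier R" for x
  proof -
    have "W +> x \<in> carrier ?Q" using x unfolding carrier_quotient_module[OF W] by blast
    then have "W +> x \<in> singular_submodule R ?Q \<longleftrightarrow> x \<in> singular_closure R W"
      using x unfolding singular_submodule_def singular_closure_def by (simp add: ann)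
    then show ?thesis by (simp only: closed)
  qed
  have "singular_submodule R ?Q = {W}"
  proof (intro equalityI subsetI)
    fix Y assume Y: "Y \<in> singular_submodule R ?Q"
    then obtain x where x: "x \<in> carrier R" "Y = W +> x"
      unfolding singular_submodule_def carrier_quotient_module[OF W] by blast
    then have "x \<in> W" using mem Y by blast
    then show "Y \<in> {W}" using coset_eq_iff[OF W x(1)] x(2) by blast
  next
    fix Y assume "Y \<in> {W}"
    moreover have "W +> \<zero> = W" using coset_eq_iff[OF W zero_closed] right_idealD(2)[OF W] by blast
    ultimately show "Y \<in> singular_submodule R ?Q"
      using mem[OF zero_closed] right_idealD(2)[OF W] by auto
  qed
  then show ?thesis
    using right_module_quotient[OF W] by (simp add: nonsingular_modules_def quotient_module_zero[OF W])
qed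

lemma quotient_projection:
  assumes I: "right_ideal R I" and W: "right_ideal R W" and "I \<subseteq> W"
  obtains g where "g \<in> right_module_hom R (quotient_module R I) (quotient_module R W)"
    "\<And>x. x \<in> carrier R \<Longrightarrow> g (I +> x) = W +> x"
proof -
  interpret W: abelian_subgroup W R by (rule right_ideal_abelian_subgroup[OF W])
  \<comment> \<open>All \<open>y\<close> in a coset of \<open>I\<close> give the same coset of
    \<open>W\<close>, so the union is that coset and no representative is chosen.\<close>
  define g where "g Y = (\<Union>y\<in>Y. W +> y)" for Y
  have g: "g (I +> x) = W +> x" if x: "x \<in> carrier R" for x
    unfolding g_def
  proof (rule UN_coset[OF I x])
    fix i assume "i \<in> I"
    then have i: "i \<in> W" "i \<in> carrier R" using assms(3) right_idealD(1)[OF W] by auto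
    have "W +> (i \<oplus> x) = set_add R (W +> i) (W +> x)" using i x by (simp add: W.a_rcos_sum)
    also have "W +> i = W +> \<zero>" using i by (simp add: W.a_rcos_const a_coset_add_zero W.a_subset)
    finally show "W +> (i \<oplus> x) = W +> x" using x by (simp add: W.a_rcos_sum)
  qed
  moreover have "g \<in> right_module_hom R (quotient_module R I) (quotient_module R W)"
    unfolding right_module_hom_def
    by (auto simp: g carrier_quotient_module[OF I] carrier_quotient_module[OF W]
        quotient_module_add[OF I] quotient_module_add[OF W]
        quotient_module_smult[OF I] quotient_module_smult[OF W])
  ultimately show thesis using that by blast
qed

text \<open>The annihilator of \<open>n\<close> contains \<open>E\<close>, so it is essential and
  \<open>n\<close> is singular.\<close>

lemma nonsingular_eq_zero:
  assumes N: "N \<in> nonsingular_modules R" and n: "n \<in> carrier N"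
    and E: "essential_right_ideal R E" and ann: "\<And>r. r \<in> E \<Longrightarrow> r \<odot>\<^bsub>N\<^esub> n = \<zero>\<^bsub>N\<^esub>"
  shows "n = \<zero>\<^bsub>N\<^esub>"
proof -
  interpret N: right_module R N using N by (simp add: nonsingular_modules_def)
  have zero_smult: "\<zero> \<odot>\<^bsub>N\<^esub> n = \<zero>\<^bsub>N\<^esub>"
    using N.rsmult_distrib_ring[of \<zero> \<zero> n] n N.rsmult_closed[of \<zero> n] by simp
  have smult_zero: "r \<odot>\<^bsub>N\<^esub> \<zero>\<^bsub>N\<^esub> = \<zero>\<^bsub>N\<^esub>" if "r \<in> carrier R" for r
    using that N.rsmult_distrib_module[of r "\<zero>\<^bsub>N\<^esub>" "\<zero>\<^bsub>N\<^esub>"] N.rsmult_closed[of r "\<zero>\<^bsub>N\<^esub>"] by simp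
  have "right_ideal R (annihilator R N n)"
    using n by (intro right_idealI)
      (auto simp: annihilator_def zero_smult smult_zero N.rsmult_distrib_ring N.rsmult_assoc)
  moreover have "E \<subseteq> annihilator R N n"
    using ann E right_ideal_memD by (auto simp: annihilator_def essential_right_ideal_def)
  ultimately have "n \<in> singular_submodule R N"
    using essential_superset[OF E] n by (simp add: singular_submodule_def)
  then show ?thesis using N by (simp add: nonsingular_modules_def)
qed

text \<open>This expresses Goldie torsion by right ideals of \<open>R\<close> alone, without a
  quantifier over modules.\<close>

lemma right_goldie_filter_iff:
  "I \<in> right_goldie_filter R \<longleftrightarrow>
    right_ideal R I \<and> essential_right_ideal R (singular_closure R I)"
proof (rule iffI; (elim conjE)?)
  assume IF: "I \<in> right_goldie_filter R"
  then have I: "right_ideal R I" by (simp add: right_goldie_filter_def torsion_filter_def)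
  \<comment> \<open>\<open>R/W\<close> is nonsingular, so the projection from \<open>R/I\<close>
    kills the coset of \<open>\<one>\<close>. Then \<open>\<one> \<in> W\<close>, and
    \<open>Z\<close> is essential because \<open>(Z : \<one>) = Z\<close>.\<close>
  define Z W where "Z = singular_closure R I" and "W = singular_closure R Z"
  have Z: "right_ideal R Z" and W: "right_ideal R W"
    using I by (simp_all add: Z_def W_def right_ideal_singular_closure)
  have "I \<subseteq> W"
    using singular_closure_superset[OF I] singular_closure_superset[OF Z] by (auto simp: Z_def W_def)
  then obtain g where g: "g \<in> right_module_hom R (quotient_module R I) (quotient_module R W)"
    and g_coset: "\<And>x. x \<in> carrier R \<Longrightarrow> g (I +> x) = W +> x"
    using quotient_projection[OF I W] by blast
  have "quotient_module R W \<in> nonsingular_modules R"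
    using I W by (intro nonsingular_quotient_module) (simp_all add: W_def Z_def singular_closure_idem2)
  moreover have "I +> \<one> \<in> carrier (quotient_module R I)"
    using I by (auto simp: carrier_quotient_module)
  ultimately have "g (I +> \<one>) = W"
    using IF g quotient_module_zero[OF W] right_goldie_filter_hom_trivial by metis
  then have "\<one> \<in> W" using coset_eq_iff[OF W] by (simp add: g_coset)
  then have "essential_right_ideal R Z" using Z by (simp add: W_def singular_closure_def colon_one)
  with I show "right_ideal R I \<and> essential_right_ideal R (singular_closure R I)"
    by (simp add: Z_def)
next
  assume I: "right_ideal R I" and E: "essential_right_ideal R (singular_closure R I)"
  note simps = carrier_quotient_module[OF I] quotient_module_smult[OF I]
  have "f X = \<zero>\<^bsub>N\<^esub>"
    if N: "N \<in> nonsingular_modules R" and f: "f \<in> right_module_hom R (quotient_module R I) N"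
      and X: "X \<in> carrier (quotient_module R I)" for X f and N :: "('a, 'a set) module"
  proof -
    interpret N: right_module R N using N by (simp add: nonsingular_modules_def)
    interpret Q: right_module R "quotient_module R I" by (rule right_module_quotient[OF I])
    have f_closed: "f (I +> x) \<in> carrier N" if "x \<in> carrier R" for x
      using f that by (auto simp: right_module_hom_def simps)
    have f_smult: "r \<odot>\<^bsub>N\<^esub> f (I +> x) = f (I +> (x \<otimes> r))" if "x \<in> carrier R" "r \<in> carrier R" for x r
    proof -
      have "I +> x \<in> carrier (quotient_module R I)" using that by (auto simp: simps)
      then show ?thesis using f that by (simp add: right_module_hom_def simps(2)[symmetric])
    qed
    have f_zero: "f I = \<zero>\<^bsub>N\<^esub>"
    proof -
      have "I +> \<zero> = I" using I by (simp add: coset_eq_iff right_idealD)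
      then have fI: "f I \<in> carrier N" and QI: "I \<in> carrier (quotient_module R I)"
        using f_closed[of \<zero>] by (auto simp: simps)
      have "f (I \<oplus>\<^bsub>quotient_module R I\<^esub> I) = f I \<oplus>\<^bsub>N\<^esub> f I"
        using f QI by (simp add: right_module_hom_def)
      moreover have "I \<oplus>\<^bsub>quotient_module R I\<^esub> I = I"
        using Q.M.l_zero[OF QI] by (simp add: quotient_module_zero[OF I])
      ultimately show ?thesis using fI by simp
    qed
    \<comment> \<open>First \<open>f\<close> kills \<open>Z(I)/I\<close>: the essential ideal
      \<open>(I : y)\<close> annihilates the image of \<open>y\<close>.\<close>
    have closure: "f (I +> y) = \<zero>\<^bsub>N\<^esub>" if y: "y \<in> singular_closure R I" for y
    proof (rule nonsingular_eq_zero[OF N])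
      have yc: "y \<in> carrier R" using y by (simp add: singular_closure_def)
      then show "f (I +> y) \<in> carrier N" by (rule f_closed)
      show "essential_right_ideal R (colon R I y)" using y by (simp add: singular_closure_def)
      fix r assume "r \<in> colon R I y"
      then have r: "r \<in> carrier R" "y \<otimes> r \<in> I" by (auto simp: colon_def)
      then have "I +> (y \<otimes> r) = I" using yc by (simp add: coset_eq_iff[OF I])
      then show "r \<odot>\<^bsub>N\<^esub> f (I +> y) = \<zero>\<^bsub>N\<^esub>" by (simp only: f_smult[OF yc r(1)] f_zero)
    qed
    obtain x where x: "x \<in> carrier R" "X = I +> x" using X by (auto simp: simps)
    \<comment> \<open>Then \<open>(Z(I) : x)\<close> annihilates the image of an arbitrary
      \<open>x\<close>, and it is essential because \<open>Z(I)\<close> is.\<close>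
    have "f (I +> x) = \<zero>\<^bsub>N\<^esub>"
    proof (rule nonsingular_eq_zero[OF N f_closed[OF x(1)] essential_colon[OF E x(1)]])
      fix r assume "r \<in> colon R (singular_closure R I) x"
      then have r: "r \<in> carrier R" "x \<otimes> r \<in> singular_closure R I" by (auto simp: colon_def)
      show "r \<odot>\<^bsub>N\<^esub> f (I +> x) = \<zero>\<^bsub>N\<^esub>" by (simp only: f_smult[OF x(1) r(1)] closure[OF r(2)])
    qed
    then show ?thesis by (simp only: x(2))
  qed
  then show "I \<in> right_goldie_filter R"
    using I right_module_quotient[OF I]
    by (simp add: right_goldie_filter_def torsion_filter_def torsion_class_def)
qed

lemma gabriel_filter_goldie: "gabriel_filter R (right_goldie_filter R)"
proof unfold_locales
  show "carrier R \<in> right_goldie_filter R"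
    using essential_superset[OF essential_carrier right_ideal_singular_closure]
      singular_closure_superset right_ideal_carrier
    by (simp add: right_goldie_filter_iff)
next
  fix I a assume "I \<in> right_goldie_filter R" "a \<in> carrier R"
  then show "colon R I a \<in> right_goldie_filter R"
    by (simp add: right_goldie_filter_iff right_ideal_colon singular_closure_colon essential_colon)
next
  fix I J assume I: "I \<in> right_goldie_filter R" and J: "right_ideal R J"
    and IJ: "\<And>a. a \<in> I \<Longrightarrow> colon R J a \<in> right_goldie_filter R"
  let ?Z2 = "singular_closure R (singular_closure R J)"
  have rI: "right_ideal R I" using I by (simp add: right_goldie_filter_iff)
  have Z: "right_ideal R (singular_closure R J)" and Z2: "right_ideal R ?Z2"
    using J by (simp_all add: right_ideal_singular_closure)
  \<comment> \<open>For \<open>a\<close> in \<open>I\<close> the closure of \<open>(J : a)\<close>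
    is \<open>(Z(J) : a)\<close>; it is essential, so \<open>a \<in> ?Z2\<close>.\<close>
  have "I \<subseteq> ?Z2"
  proof
    fix a assume a: "a \<in> I"
    have "a \<in> carrier R" using rI a by (rule right_ideal_memD)
    then show "a \<in> ?Z2"
      using IJ[OF a] J
      by (simp add: right_goldie_filter_iff singular_closure_colon
          singular_closure_def[of R "singular_closure R J"])
  qed
  \<comment> \<open>Since \<open>?Z2\<close> is closed, it contains the essential ideal
    \<open>Z(I)\<close> too.\<close>
  then have "singular_closure R I \<subseteq> ?Z2"
    using singular_closure_mono[OF rI Z2] singular_closure_idem2[OF J] by simp
  then have "essential_right_ideal R ?Z2"
    using I Z2 essential_superset unfolding right_goldie_filter_iff by blast
  \<comment> \<open>Descent from \<open>?Z2\<close> to \<open>Z(J)\<close>: with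
    \<open>E = ?Z2\<close>, the remaining premise is the definition of \<open>?Z2\<close>.\<close>
  then have "essential_right_ideal R (singular_closure R J)"
    by (rule essential_singular_closure[OF J]) (simp add: singular_closure_def)
  with J show "J \<in> right_goldie_filter R" by (simp add: right_goldie_filter_iff)
qed (simp add: right_goldie_filter_iff)

end

theorem corollary3:
  fixes R :: "('a, 'm) ring_scheme"
  assumes "ring R"
  shows "differential_filter (enveloping_ring R) (symmetric_lambek_filter R) \<and>
    differential_filter (enveloping_ring R) (symmetric_goldie_filter R)"
  unfolding symmetric_lambek_filter_def symmetric_goldie_filter_def
    left_lambek_filter_def left_goldie_filter_def
  \<comment> \<open>The left filters are the right filters of \<open>op_ring R\<close>, so each
    one-sided result is applied to both rings.\<close>
  using assms ring_op_ring[OF assms]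
  by (intro conjI differential_filter_symmetric gabriel_filter_lambek ring.gabriel_filter_goldie)

end
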